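(* Every one-dimensional Lie subalgebra of the symmetry algebra $L$ of the Zabolotskaya–Khokhlov equation is equivalent, under the adjoint representation of the symmetry group $G$, to (the span of) one of $$\mathcal L_{1,1}=\{\mathbf x_{(1)}\},\qquad \mathcal L_{1,2}=\{\mathbf y_{(1)}\},\qquad \mathcal L_{1,3}=\{\mathbf v_0\},\qquad \mathcal L_{1,4}=\{k_0\mathbf v_0+\mathbf z_{(1)}\}\ \ (k_0\in\mathbb R),$$ where $\mathbf x_{(1)}=\partial_x$, $\mathbf y_{(1)}=\partial_y$, $\mathbf z_{(1)}=\partial_t$. Moreover, these four types of subalgebras are pairwise non-equivalent under the adjoint representation of $G$.
   Context: The Zabolotskaya–Khokhlov (ZK) equation is $u_{xt}-(uu_x)_x-u_{yy}=0$ for $u=u(t,x,y)$. Its symmetry algebra $L$ is the real Lie algebra of vector fields on $(t,x,y,u)$-space consisting of all $k_0\mathbf v_0+\mathbf x_g+\mathbf y_h+\mathbf z_f$, $k_0\in\mathbb R$, with $\mathbf v_0=2x\partial_x+y\partial_y+2u\partial_u$, $\mathbf x_g=g\partial_x-g'\partial_u$, $\mathbf y_h=\tfrac12 yh'\partial_x+h\partial_y-\tfrac12 yh''\partial_u$, $\mathbf z_f=f\partial_t+\tfrac16(2xf'+y^2f'')\partial_x+\tfrac{2y}{3}f'\partial_y+\tfrac16(-4uf'-2xf''-y^2f''')\partial_u$, where $f,g,h$ are real $C^\infty$ functions of $t$ on some open interval of $\mathbb R$ and $'=d/dt$. For a constant $q$, $\mathbf w_{(q)}$ denotes $\mathbf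 w_q$ with $q$ the constant function ($\mathbf w=\mathbf x,\mathbf y,\mathbf z$). For $V,\mathbf v\in L$, $\mathrm{Ad}(\exp(\varepsilon V))\mathbf v$ is the pushforward of $\mathbf v$ by the local flow $\exp(\varepsilon V)$ of $V$; equivalently it is the solution $\mathbf v(\varepsilon)$ of $\frac{d}{d\varepsilon}\mathbf v(\varepsilon)=[\mathbf v(\varepsilon),V]$, $\mathbf v(0)=\mathbf v$. $G$ is generated by such flows, and $\mathrm{Ad}_B$ for $B\in G$ is the corresponding composition. Subalgebras $S_1,S_2$ are equivalent if $S_2=\mathrm{Ad}_B(S_1)$ for some $B\in G$. Everything is local in $t$: the open interval on which the functions of $t$ are defined may be shrunk to a nonempty open subinterval (for instance one on which a not identically vanishing function is nowhere zero). *)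

theory Defs
  imports "HOL-Analysis.Analysis" "HOL-Library.Function_Algebras"
begin

text \<open>Points are \<open>(t, x, y, u)\<close>; a vector field is given by its components with respect to
  \<open>\<partial>\<^sub>t, \<partial>\<^sub>x, \<partial>\<^sub>y, \<partial>\<^sub>u\<close>. A field on \<open>cyl I\<close>, for an open interval \<open>I\<close> of the \<open>t\<close>-axis, is
  represented by a total function that is \<open>0\<close> off \<open>cyl I\<close>, so that equality of functions is
  equality of vector fields on \<open>cyl I\<close>.\<close>

type_synonym point = "real \<times> real \<times> real \<times> real"
type_synonym vfield = "point \<Rightarrow> point"

definition open_interval :: "real set \<Rightarrow> bool" where
  "open_interval I \<longleftrightarrow> open I \<and> is_interval I \<and> I \<noteq> {}"

definition cyl :: "real set \<Rightarrow> point set" where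
  "cyl I = I \<times> UNIV"

definition restr :: "real set \<Rightarrow> vfield \<Rightarrow> vfield" where
  "restr I v = (\<lambda>p. if p \<in> cyl I then v p else 0)"

global_interpretation vf: vector_space "\<lambda>(c::real) (v::vfield) p. c *\<^sub>R v p"
  defines vf_span = vf.span
    and vf_subspace = vf.subspace
    and vf_dim = vf.dim
  by unfold_locales (auto simp: fun_eq_iff scaleR_add_right scaleR_add_left)

text \<open>\<open>C\<^sup>\<infinity>\<close> on an open set of reals.\<close>

definition smooth_on :: "real set \<Rightarrow> (real \<Rightarrow> real) \<Rightarrow> bool" where
  "smooth_on I f \<longleftrightarrow> (\<forall>n. \<forall>t\<in>I. ((deriv ^^ n) f) differentiable (at t))"

definition V0 :: vfield where
  "V0 = (\<lambda>(t, x, y, u). (0, 2 * x, y, 2 * u))"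

definition X :: "(real \<Rightarrow> real) \<Rightarrow> vfield" where
  "X g = (\<lambda>(t, x, y, u). (0, g t, 0, - deriv g t))"

definition Y :: "(real \<Rightarrow> real) \<Rightarrow> vfield" where
  "Y h = (\<lambda>(t, x, y, u).
     (0, 1/2 * y * deriv h t, h t, - 1/2 * y * (deriv ^^ 2) h t))"

definition Z :: "(real \<Rightarrow> real) \<Rightarrow> vfield" where
  "Z f = (\<lambda>(t, x, y, u).
     (f t,
      1/6 * (2 * x * deriv f t + y\<^sup>2 * (deriv ^^ 2) f t),
      2 * y / 3 * deriv f t,
      1/6 * (- 4 * u * deriv f t - 2 * x * (deriv ^^ 2) f t - y\<^sup>2 * (deriv ^^ 3) f t)))"

text \<open>The symmetry algebra \<open>L\<close>, with the functions of \<open>t\<close> defined on \<open>I\<close>.\<close>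

definition zk_algebra :: "real set \<Rightarrow> vfield set" where
  "zk_algebra I =
     {restr I (\<lambda>p. k0 *\<^sub>R V0 p + X g p + Y h p + Z f p) | k0 g h f.
        smooth_on I g \<and> smooth_on I h \<and> smooth_on I f}"

definition lie_bracket :: "real set \<Rightarrow> vfield \<Rightarrow> vfield \<Rightarrow> vfield" where
  "lie_bracket I v w = restr I
     (\<lambda>p. frechet_derivative w (at p) (v p) - frechet_derivative v (at p) (w p))"

definition lie_subalgebra :: "real set \<Rightarrow> vfield set \<Rightarrow> bool" where
  "lie_subalgebra I S \<longleftrightarrow>
     S \<subseteq> zk_algebra I \<and> vf_subspace S \<and> (\<forall>v\<in>S. \<forall>w\<in>S. lie_bracket I v w \<in> S)"

text \<open>\<open>\<Phi> s\<close> is the flow map \<open>exp(s V)\<close> on \<open>cyl J\<close>, for \<open>s\<close> between \<open>0\<close> and \<open>\<epsilon>\<close> (of either sign), of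
  a field \<open>V\<close> on \<open>cyl K\<close>. Differentiability in the initial point holds automatically for the
  fields of \<open>L\<close>, by smooth dependence on initial conditions.\<close>

definition local_flow ::
  "real set \<Rightarrow> vfield \<Rightarrow> real set \<Rightarrow> real \<Rightarrow> (real \<Rightarrow> point \<Rightarrow> point) \<Rightarrow> bool" where
  "local_flow K V J \<epsilon> \<Phi> \<longleftrightarrow>
     (\<forall>p\<in>cyl J. \<Phi> 0 p = p \<and>
        (\<forall>s\<in>closed_segment 0 \<epsilon>. \<Phi> s p \<in> cyl K \<and>
           ((\<lambda>r. \<Phi> r p) has_vector_derivative V (\<Phi> s p)) (at s within closed_segment 0 \<epsilon>))) \<and>
     (\<forall>s\<in>closed_segment 0 \<epsilon>. \<Phi> s differentiable_on cyl J)"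

definition pushforward ::
  "real set \<Rightarrow> real set \<Rightarrow> (point \<Rightarrow> point) \<Rightarrow> vfield \<Rightarrow> vfield" where
  "pushforward J J' \<phi> v = restr J'
     (\<lambda>q. let p = inv_into (cyl J) \<phi> q in frechet_derivative \<phi> (at p) (v p))"

text \<open>\<open>Ad_G J B J' A\<close>: the composition \<open>B \<in> G\<close> of local flows of fields in \<open>L\<close> is defined on
  \<open>cyl J\<close> and maps it onto \<open>cyl J'\<close>, and \<open>A = Ad\<^sub>B\<close>, taking fields on \<open>cyl J\<close> to fields on
  \<open>cyl J'\<close>. The flow of a field on \<open>cyl K\<close> may move the \<open>t\<close>-interval inside \<open>K\<close>; the domain of
  a flow map is always a cylinder because all fields in \<open>L\<close> are complete in \<open>x, y, u\<close>.\<close>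

inductive Ad_G ::
  "real set \<Rightarrow> (point \<Rightarrow> point) \<Rightarrow> real set \<Rightarrow> (vfield \<Rightarrow> vfield) \<Rightarrow> bool" where
  Id: "open_interval J \<Longrightarrow> Ad_G J id J id"
| Flow: "\<lbrakk>Ad_G J B J' A; open_interval K; V \<in> zk_algebra K; local_flow K V J' \<epsilon> \<Phi>;
          open_interval J''; \<Phi> \<epsilon> ` cyl J' = cyl J''\<rbrakk>
         \<Longrightarrow> Ad_G J (\<Phi> \<epsilon> \<circ> B) J'' (pushforward J' J'' (\<Phi> \<epsilon>) \<circ> A)"

text \<open>Equivalence of a subalgebra on \<open>cyl J\<close> with one on \<open>cyl J'\<close>.\<close>

definition equivalent :: "real set \<Rightarrow> vfield set \<Rightarrow> real set \<Rightarrow> vfield set \<Rightarrow> bool" where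
  "equivalent J S J' S' \<longleftrightarrow> (\<exists>B A. Ad_G J B J' A \<and> S' = A ` S)"

definition L11 :: "real set \<Rightarrow> vfield set" where
  "L11 J = vf_span {restr J (X (\<lambda>t. 1))}"

definition L12 :: "real set \<Rightarrow> vfield set" where
  "L12 J = vf_span {restr J (Y (\<lambda>t. 1))}"

definition L13 :: "real set \<Rightarrow> vfield set" where
  "L13 J = vf_span {restr J V0}"

definition L14 :: "real \<Rightarrow> real set \<Rightarrow> vfield set" where
  "L14 k0 J = vf_span {restr J (\<lambda>p. k0 *\<^sub>R V0 p + Z (\<lambda>t. 1) p)}"

definition L1_types :: "real set \<Rightarrow> vfield set set list" where
  "L1_types J = [{L11 J}, {L12 J}, {L13 J}, range (\<lambda>k0. L14 k0 J)]"

end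

theory Submission
  imports Defs
begin

text \<open>Normal forms: the flow of a field \<open>W\<close> of \<open>L\<close> pushes \<open>W\<close> to itself. If \<open>f > 0\<close> near \<open>t\<^sub>0\<close>, cut off
  the coefficients of \<open>v = k\<^sub>0 v\<^sub>0 + x\<^sub>g + y\<^sub>h + z\<^sub>f\<close> so that the resulting global field \<open>W\<close> equals \<open>v\<close>
  near \<open>t\<^sub>0\<close> and \<open>k\<^sub>0 v\<^sub>0 + z\<^sub>1\<close> further to the right; flowing along \<open>W\<close> until \<open>t\<close> is in the second
  region carries \<open>v\<close> to its normal form in one step. If \<open>f = 0\<close>, the fields \<open>x\<^sub>R\<close> and \<open>y\<^sub>h\<close> with
  \<open>h = R\<^sup>2\<close> commute with \<open>z\<^sub>F\<close> for \<open>F = R\<^sup>3\<close>, so they are invariant under its flow, and the same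
  extension argument applied to \<open>R\<close> yields \<open>x\<^sub>1\<close> and \<open>y\<^sub>1\<close>. The other terms are removed by explicit flows
  of \<open>x\<^sub>g + y\<^sub>h\<close>, which do not move \<open>t\<close>.

  Non-equivalence: every map in \<open>G\<close> preserves the fibrations by \<open>t\<close> and by \<open>(t, y)\<close> and is affine along
  the fibres in the way forced by the linear ODEs of the flow, so on vertical vectors its derivative is
  triangular with nonzero diagonal. Hence it respects being vertical, having zero \<open>\<partial>\<^sub>y\<close>-component and
  vanishing at a point, and these properties separate the four types.\<close>

section \<open>Smooth functions and cutoffs\<close>

text \<open>\<open>G\<close> offers nothing but flows, so even a change of the variable t has to be
  realised by flows on whole cylinders, while a field given only on \<open>I\<close> may run out of
  \<open>I\<close> in finite time. Making the extended field standard outside a compact interval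
  removes this obstacle: its flow is complete. Completeness, bijectivity and differentiability in
  the initial point are not taken from ODE theory but read off a chart in which the field is a
  translation; the equations for t, y, x, u decouple in this order, so the chart only takes
  quadratures. Along z_F the coordinates x, y, u scale with weights F^(1/3), F^(2/3), F^(-2/3); this
  is why F = R^3 is paired with x_R and y_h for h = R^2. The extension keeps a coefficient positive,
  so a negative one is first made positive by rescaling the generator, which leaves the span
  unchanged. In the non-equivalence part the flows are arbitrary: f may vanish and the field lives
  on \<open>K\<close> only. All information then comes from the differential equation itself,
  through uniqueness for t and homogeneous linear equations for differences of trajectories over the
  same t.\<close>

lemma smooth_on_coinduct:
  assumes "open U" "P f"
    and step: "\<And>f. P f \<Longrightarrow> \<exists>f'. P f' \<and> (\<forall>t\<in>U. (f has_real_derivative f' t) (at t))"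
  shows "smooth_on U f"
proof -
  \<comment> \<open>The iterates of \<open>deriv\<close> are fixed total functions, while
    \<open>step\<close> controls derivatives on \<open>U\<close> only. So each iterate is compared
    with a member of \<open>P\<close> on \<open>U\<close>, and openness of \<open>U\<close> lets the
    comparison survive one more \<open>deriv\<close>.\<close>
  have *: "\<exists>g. P g \<and> (\<forall>t\<in>U. (deriv ^^ n) f t = g t)" for n
  proof (induction n)
    case 0
    then show ?case using \<open>P f\<close> by auto
  next
    case (Suc n)
    then obtain g where g: "P g" "\<And>t. t \<in> U \<Longrightarrow> (deriv ^^ n) f t = g t" by blast
    obtain g' where g': "P g'" "\<And>t. t \<in> U \<Longrightarrow> (g has_real_derivative g' t) (at t)"
      using step[OF g(1)] by blast
    have "((deriv ^^ n) f has_real_derivative g' t) (at t)" if "t \<in> U" for t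
      by (rule has_field_derivative_transform_within_open[OF g'(2) \<open>open U\<close>]) (use that g in auto)
    then have "\<forall>t\<in>U. (deriv ^^ Suc n) f t = g' t" by (simp add: DERIV_imp_deriv)
    then show ?case using g' by blast
  qed
  show ?thesis unfolding smooth_on_def
  proof (intro allI ballI)
    fix n t assume t: "t \<in> U"
    obtain g where g: "P g" "\<And>t. t \<in> U \<Longrightarrow> (deriv ^^ n) f t = g t" using * by blast
    obtain g' where g': "(g has_real_derivative g' t) (at t)"
      using step[OF g(1)] t by blast
    have "((deriv ^^ n) f has_real_derivative g' t) (at t)"
      by (rule has_field_derivative_transform_within_open[OF g' \<open>open U\<close>]) (use t g in auto)
    then show "(deriv ^^ n) f differentiable at t" using real_differentiable_def by blast
  qed
qed

lemma smooth_on_deriv: "smooth_on U f \<Longrightarrow> smooth_on U (deriv f)"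
  unfolding smooth_on_def by (metis comp_apply funpow_Suc_right)

lemma smooth_on_funpow_deriv: "smooth_on U f \<Longrightarrow> smooth_on U ((deriv ^^ n) f)"
  by (induction n) (auto intro: smooth_on_deriv)

lemma smooth_on_DERIV:
  "smooth_on U f \<Longrightarrow> t \<in> U \<Longrightarrow> (f has_real_derivative deriv f t) (at t)"
  unfolding smooth_on_def by (metis funpow_0 DERIV_deriv_iff_real_differentiable)

lemma smooth_on_DERIV_funpow:
  "smooth_on U f \<Longrightarrow> t \<in> U \<Longrightarrow>
    ((deriv ^^ n) f has_real_derivative (deriv ^^ Suc n) f t) (at t)"
  using smooth_on_DERIV[OF smooth_on_funpow_deriv] by simp

lemma smooth_on_DERIV_2:
  "smooth_on U f \<Longrightarrow> t \<in> U \<Longrightarrow> (deriv f has_real_derivative (deriv ^^ 2) f t) (at t)"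
  using smooth_on_DERIV_funpow[of U f t 1] by (simp add: numeral_2_eq_2)

lemma smooth_on_DERIV_3:
  "smooth_on U f \<Longrightarrow> t \<in> U \<Longrightarrow> ((deriv ^^ 2) f has_real_derivative (deriv ^^ 3) f t) (at t)"
  using smooth_on_DERIV_funpow[of U f t 2] by (simp add: numeral_3_eq_3 numeral_2_eq_2)

lemma smooth_on_subset: "smooth_on U f \<Longrightarrow> V \<subseteq> U \<Longrightarrow> smooth_on V f"
  unfolding smooth_on_def by auto

lemma smooth_on_Un: "smooth_on U f \<Longrightarrow> smooth_on V f \<Longrightarrow> smooth_on (U \<union> V) f"
  unfolding smooth_on_def by auto

lemma smooth_on_imp_continuous_on: "smooth_on U f \<Longrightarrow> continuous_on U f"
  by (meson DERIV_isCont continuous_at_imp_continuous_on smooth_on_DERIV)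

lemma funpow_deriv_cong:
  assumes "open U" "\<And>t. t \<in> U \<Longrightarrow> f t = g t" "t \<in> U"
  shows "(deriv ^^ n) f t = (deriv ^^ n) (g :: real \<Rightarrow> real) t"
  using assms(3)
proof (induction n arbitrary: t)
  case (Suc n)
  have "\<forall>\<^sub>F s in nhds t. (deriv ^^ n) f s = (deriv ^^ n) g s"
    using Suc assms(1) eventually_nhds by blast
  then show ?case by (simp add: deriv_cong_ev)
qed (use assms in auto)

lemma deriv_cong_open:
  "open U \<Longrightarrow> (\<And>t. t \<in> U \<Longrightarrow> f t = g t) \<Longrightarrow> t \<in> U \<Longrightarrow> deriv f t = deriv (g :: real \<Rightarrow> real) t"
  using funpow_deriv_cong[of U f g t 1] by simp

lemma smooth_on_cong:
  assumes "open U" "\<And>t. t \<in> U \<Longrightarrow> f t = g t" "smooth_on U g"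
  shows "smooth_on U f"
proof (rule smooth_on_coinduct[where P = "\<lambda>f. \<exists>g. smooth_on U g \<and> (\<forall>t\<in>U. f t = g t)"])
  fix f assume "\<exists>g. smooth_on U g \<and> (\<forall>t\<in>U. f t = g t)"
  then obtain g where g: "smooth_on U g" "\<forall>t\<in>U. f t = g t" by blast
  have "(f has_real_derivative deriv g t) (at t)" if "t \<in> U" for t
    by (rule has_field_derivative_transform_within_open[OF smooth_on_DERIV[OF g(1) that] \<open>open U\<close>])
       (use that g in auto)
  then show "\<exists>f'. (\<exists>g. smooth_on U g \<and> (\<forall>t\<in>U. f' t = g t)) \<and>
      (\<forall>t\<in>U. (f has_real_derivative f' t) (at t))"
    using smooth_on_deriv[OF g(1)] by blast
qed (use assms in auto)

lemma smooth_on_const: "smooth_on U (\<lambda>_. c)"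
proof -
  have "smooth_on UNIV (\<lambda>_. c)"
    by (rule smooth_on_coinduct[where P = "\<lambda>f. \<exists>c. f = (\<lambda>_. c)"]) (auto intro!: exI[of _ "\<lambda>_. 0"])
  then show ?thesis using smooth_on_subset by blast
qed

lemma smooth_on_antiderivative:
  assumes "open U" "smooth_on U f'" "\<And>t. t \<in> U \<Longrightarrow> (f has_real_derivative f' t) (at t)"
  shows "smooth_on U f"
  by (rule smooth_on_coinduct[where P = "\<lambda>g. g = f \<or> smooth_on U g"])
     (use assms smooth_on_deriv smooth_on_DERIV in blast)+

lemma smooth_on_ident: "smooth_on U (\<lambda>t. t)"
proof -
  have "smooth_on UNIV (\<lambda>t. t)"
    by (rule smooth_on_antiderivative[OF _ smooth_on_const[of _ 1]]) (auto intro: derivative_eq_intros)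
  then show ?thesis using smooth_on_subset by blast
qed

text \<open>Closed under derivatives, which gives all closure properties of \<^const>\<open>smooth_on\<close> at once by
  coinduction.\<close>

inductive smooth_gen :: "real set \<Rightarrow> (real \<Rightarrow> real) \<Rightarrow> bool" for U where
  base: "smooth_on U f \<Longrightarrow> smooth_gen U f"
| add: "smooth_gen U f \<Longrightarrow> smooth_gen U g \<Longrightarrow> smooth_gen U (\<lambda>t. f t + g t)"
| mult: "smooth_gen U f \<Longrightarrow> smooth_gen U g \<Longrightarrow> smooth_gen U (\<lambda>t. f t * g t)"
| compose: "smooth_on V f \<Longrightarrow> smooth_gen U g \<Longrightarrow> g ` U \<subseteq> V \<Longrightarrow> smooth_gen U (\<lambda>t. f (g t))"

lemma smooth_on_smooth_gen:
  assumes "open U" "smooth_gen U f" shows "smooth_on U f"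
proof (rule smooth_on_coinduct[where P = "smooth_gen U", OF assms])
  fix f assume "smooth_gen U f"
  then show "\<exists>f'. smooth_gen U f' \<and> (\<forall>t\<in>U. (f has_real_derivative f' t) (at t))"
  proof induction
    case (base f)
    then show ?case
      by (intro exI[of _ "deriv f"] conjI ballI smooth_gen.base smooth_on_deriv smooth_on_DERIV)
  next
    case (add f g)
    then obtain f' g' where "smooth_gen U f'" "\<forall>t\<in>U. (f has_real_derivative f' t) (at t)"
      "smooth_gen U g'" "\<forall>t\<in>U. (g has_real_derivative g' t) (at t)" by blast
    then show ?case
      by (intro exI[of _ "\<lambda>t. f' t + g' t"] conjI ballI smooth_gen.add DERIV_add) simp_all
  next
    case (mult f g)
    then obtain f' g' where "smooth_gen U f'" "\<forall>t\<in>U. (f has_real_derivative f' t) (at t)"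
      "smooth_gen U g'" "\<forall>t\<in>U. (g has_real_derivative g' t) (at t)" by blast
    then show ?case using mult.hyps
      by (intro exI[of _ "\<lambda>t. f' t * g t + g' t * f t"] conjI ballI
          smooth_gen.add[of U "\<lambda>t. f' t * g t" "\<lambda>t. g' t * f t"]
          smooth_gen.mult DERIV_mult) simp_all
  next
    case (compose V f g)
    then obtain g' where g': "smooth_gen U g'" "\<forall>t\<in>U. (g has_real_derivative g' t) (at t)" by blast
    show ?case
    proof (intro exI[of _ "\<lambda>t. deriv f (g t) * g' t"] conjI ballI)
      show "smooth_gen U (\<lambda>t. deriv f (g t) * g' t)"
        by (rule smooth_gen.mult[OF smooth_gen.compose[OF smooth_on_deriv[OF compose.hyps(1)]
            compose.hyps(2,3)] g'(1)])
      fix t assume "t \<in> U"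
      then show "((\<lambda>t. f (g t)) has_real_derivative deriv f (g t) * g' t) (at t)"
        using compose.hyps g' by (intro DERIV_chain2[where f = f] smooth_on_DERIV[of V]) auto
    qed
  qed
qed

lemma smooth_on_add:
  "open U \<Longrightarrow> smooth_on U f \<Longrightarrow> smooth_on U g \<Longrightarrow> smooth_on U (\<lambda>t. f t + g t)"
  by (simp add: smooth_on_smooth_gen smooth_gen.intros)

lemma smooth_on_mult:
  "open U \<Longrightarrow> smooth_on U f \<Longrightarrow> smooth_on U g \<Longrightarrow> smooth_on U (\<lambda>t. f t * g t)"
  by (simp add: smooth_on_smooth_gen smooth_gen.intros)

lemma smooth_on_compose:
  "open U \<Longrightarrow> smooth_on V f \<Longrightarrow> smooth_on U g \<Longrightarrow> g ` U \<subseteq> V \<Longrightarrow> smooth_on U (\<lambda>t. f (g t))"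
  by (rule smooth_on_smooth_gen) (auto intro: smooth_gen.intros)

lemma smooth_on_cmult: "open U \<Longrightarrow> smooth_on U f \<Longrightarrow> smooth_on U (\<lambda>t. c * f t)"
  by (intro smooth_on_mult smooth_on_const)

lemma smooth_on_diff:
  "open U \<Longrightarrow> smooth_on U f \<Longrightarrow> smooth_on U g \<Longrightarrow> smooth_on U (\<lambda>t. f t - g t)"
  using smooth_on_add[of U f "\<lambda>t. - 1 * g t"] smooth_on_cmult[of U g "- 1"] by simp

lemma smooth_on_powr: "smooth_on {0<..} (\<lambda>t. t powr a)"
proof (rule smooth_on_coinduct[where P = "\<lambda>f. \<exists>k a. f = (\<lambda>t. k * t powr a)"])
  show "\<exists>k aa. (\<lambda>t. t powr a) = (\<lambda>t. k * t powr aa)" by (rule exI[of _ 1]) auto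
next
  fix f :: "real \<Rightarrow> real" assume "\<exists>k a. f = (\<lambda>t. k * t powr a)"
  then obtain k a where f: "f = (\<lambda>t. k * t powr a)" by blast
  have "\<forall>t\<in>{0<..}. (f has_real_derivative (k * a) * t powr (a - 1)) (at t)"
    unfolding f by (auto intro!: derivative_eq_intros)
  then show "\<exists>f'. (\<exists>k a. f' = (\<lambda>t. k * t powr a)) \<and>
     (\<forall>t\<in>{0<..}. (f has_real_derivative f' t) (at t))" by blast
qed simp

lemma smooth_on_powr_compose:
  "open U \<Longrightarrow> smooth_on U f \<Longrightarrow> (\<And>t. t \<in> U \<Longrightarrow> f t > 0) \<Longrightarrow> smooth_on U (\<lambda>t. f t powr a)"
  by (rule smooth_on_compose[OF _ smooth_on_powr]) auto

lemma smooth_on_divide: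
  assumes "open U" "smooth_on U f" "smooth_on U g" "\<And>t. t \<in> U \<Longrightarrow> g t > 0"
  shows "smooth_on U (\<lambda>t. f t / g t)"
proof (rule smooth_on_cong[OF \<open>open U\<close>])
  show "smooth_on U (\<lambda>t. f t * g t powr (- 1))"
    using assms by (intro smooth_on_mult smooth_on_powr_compose)
  show "f t / g t = f t * g t powr (- 1)" if "t \<in> U" for t
    using assms(4)[OF that] by (simp add: powr_minus divide_inverse)
qed

section \<open>A flat function and smooth cutoffs\<close>

lemma poly_exp_tendsto_0:
  "((\<lambda>x::real. poly p x * exp (- x)) \<longlongrightarrow> 0) at_top"
proof -
  have "((\<lambda>x. \<Sum>i\<le>degree p. coeff p i * (x ^ i / exp x)) \<longlongrightarrow> (\<Sum>i\<le>degree p. coeff p i * 0)) at_top"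
    by (intro tendsto_sum tendsto_mult tendsto_const tendsto_power_div_exp_0)
  moreover have "(\<lambda>x. \<Sum>i\<le>degree p. coeff p i * (x ^ i / exp x)) = (\<lambda>x. poly p x * exp (- x))"
    by (simp add: poly_altdef sum_distrib_right exp_minus divide_inverse mult.assoc)
  ultimately show ?thesis by simp
qed

definition flat :: "real \<Rightarrow> real" where
  "flat t = (if t > 0 then exp (- (1 / t)) else 0)"

text \<open>With s = 1/t the chain rule turns p(s) exp(-s) into s^2 (p(s) - p'(s)) exp(-s), and
  \<open>[:0, 0, 1:]\<close> is s^2. The family indexed by polynomials is thus closed under
  differentiation, which is what coinduction needs for \<open>flat\<close>.\<close>

lemma DERIV_poly_exp_inverse:
  fixes p :: "real poly"
  defines "f \<equiv> \<lambda>p t. if t > 0 then poly p (1 / t) * exp (- (1 / t)) else (0::real)"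
  shows "(f p has_real_derivative f ([:0, 0, 1:] * (p - pderiv p)) t) (at t)"
proof -
  consider "t > 0" | "t < 0" | "t = 0" by linarith
  then show ?thesis
  proof cases
    case 1
    have "((\<lambda>t. poly p (1 / t) * exp (- (1 / t))) has_real_derivative
        f ([:0, 0, 1:] * (p - pderiv p)) t) (at t)"
      using 1 unfolding f_def
      by (auto intro!: derivative_eq_intros DERIV_chain2[OF poly_DERIV]
          simp: field_simps power2_eq_square)
    then show ?thesis
      by (rule has_field_derivative_transform_within_open[where S = "{0<..}"])
         (use 1 in \<open>auto simp: f_def\<close>)
  next
    case 2
    have "((\<lambda>t. 0) has_real_derivative f ([:0, 0, 1:] * (p - pderiv p)) t) (at t)"
      using 2 by (simp add: f_def)
    then show ?thesis
      by (rule has_field_derivative_transform_within_open[where S = "{..<0}"])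
         (use 2 in \<open>auto simp: f_def\<close>)
  next
    case 3
    \<comment> \<open>The difference quotient at 0 contributes a further factor s = 1/h, hence
      \<open>pCons 0 p\<close>; the exponential beats every polynomial in s.\<close>
    have "((\<lambda>h. poly (pCons 0 p) (inverse h) * exp (- inverse h)) \<longlongrightarrow> 0) (at_right 0)"
      by (rule filterlim_compose[OF poly_exp_tendsto_0 filterlim_inverse_at_top_right])
    then have "((\<lambda>h. f p h / h) \<longlongrightarrow> 0) (at_right 0)"
      by (rule Lim_transform_eventually)
         (auto simp: eventually_at_filter f_def field_simps)
    moreover have "((\<lambda>h. f p h / h) \<longlongrightarrow> 0) (at_left 0)"
      by (rule tendsto_eventually) (auto simp: eventually_at_filter f_def)
    ultimately have "((\<lambda>h. f p h / h) \<longlongrightarrow> 0) (at 0)"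
      using filterlim_at_split by blast
    then show ?thesis using 3 unfolding DERIV_def by (simp add: f_def)
  qed
qed

lemma smooth_on_flat: "smooth_on UNIV flat"
proof -
  define f where "f = (\<lambda>p t. if t > 0 then poly p (1 / t) * exp (- (1 / t)) else (0::real))"
  have eq: "flat = f 1" by (auto simp: flat_def f_def)
  have sm: "smooth_on UNIV (f p)" for p
    by (rule smooth_on_coinduct[where P = "\<lambda>g. \<exists>p. g = f p"])
       (use DERIV_poly_exp_inverse in \<open>auto simp: f_def\<close>)
  show ?thesis unfolding eq by (rule sm)
qed

lemma smooth_cutoff:
  fixes t0 r :: real
  assumes "r > 0"
  obtains \<eta> where "smooth_on UNIV \<eta>" "\<And>t. 0 \<le> \<eta> t" "\<And>t. \<eta> t \<le> 1"
    "\<And>t. \<bar>t - t0\<bar> < r \<Longrightarrow> \<eta> t = 1" "\<And>t. \<bar>t - t0\<bar> \<ge> 2 * r \<Longrightarrow> \<eta> t = 0"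
proof
  \<comment> \<open>\<open>N\<close> vanishes exactly when \<open>\<bar>t - t0\<bar> \<ge> 2r\<close>, and \<open>M\<close> exactly when \<open>\<bar>t - t0\<bar> \<le> r\<close>.\<close>
  define N where "N = (\<lambda>t. flat ((2 * r)\<^sup>2 - (t - t0)\<^sup>2))"
  define M where "M = (\<lambda>t. flat ((t - t0)\<^sup>2 - r\<^sup>2))"
  let ?\<eta> = "\<lambda>t. N t / (N t + M t)"
  have nn: "N t \<ge> 0" "M t \<ge> 0" for t by (auto simp: N_def M_def flat_def)
  have pos: "N t + M t > 0" for t
  proof (cases "\<bar>t - t0\<bar> < 2 * r")
    case True
    then have "(t - t0)\<^sup>2 < (2 * r)\<^sup>2" by (metis abs_ge_zero power2_abs power_strict_mono zero_less_numeral)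
    then have "N t > 0" by (simp add: N_def flat_def)
    then show ?thesis using nn by (simp add: add_pos_nonneg)
  next
    case False
    then have "r < \<bar>t - t0\<bar>" using assms by linarith
    then have "r\<^sup>2 < (t - t0)\<^sup>2" using assms
      by (metis less_le power2_abs power_strict_mono zero_less_numeral)
    then have "M t > 0" by (simp add: M_def flat_def)
    then show ?thesis using nn by (simp add: add_nonneg_pos)
  qed
  have "smooth_on UNIV N" "smooth_on UNIV M" unfolding N_def M_def
    by (intro smooth_on_compose[OF _ smooth_on_flat] smooth_on_diff smooth_on_mult
        smooth_on_const smooth_on_ident | simp add: power2_eq_square)+
  then show "smooth_on UNIV ?\<eta>" using pos by (intro smooth_on_divide smooth_on_add) auto
  show "0 \<le> ?\<eta> t" "?\<eta> t \<le> 1" for t using nn pos[of t] by auto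
  show "?\<eta> t = 1" if "\<bar>t - t0\<bar> < r" for t
  proof -
    have "(t - t0)\<^sup>2 < r\<^sup>2" using that by (metis abs_ge_zero power2_abs power_strict_mono zero_less_numeral)
    then have "M t = 0" by (simp add: M_def flat_def)
    then show ?thesis using pos[of t] by simp
  qed
  show "?\<eta> t = 0" if "\<bar>t - t0\<bar> \<ge> 2 * r" for t
  proof -
    have "(2 * r)\<^sup>2 \<le> (t - t0)\<^sup>2" using that assms by (metis less_imp_le mult_pos_pos power2_abs power_mono zero_less_numeral)
    then show ?thesis by (simp add: N_def flat_def)
  qed
qed

text \<open>The values of \<open>f\<close> off \<open>U\<close> are uncontrolled. The product is
  smooth on \<open>U\<close> as a product and on the open set \<open>- C\<close> because it vanishes
  there; \<open>C \<subseteq> U\<close> makes the two sets cover the line.\<close>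

lemma smooth_on_cutoff_mult:
  assumes "open U" "smooth_on U f" "smooth_on UNIV \<eta>" "closed C" "C \<subseteq> U"
    and "\<And>t. t \<notin> C \<Longrightarrow> \<eta> t = 0"
  shows "smooth_on UNIV (\<lambda>t. \<eta> t * f t)"
proof -
  have "smooth_on U (\<lambda>t. \<eta> t * f t)"
    using assms by (intro smooth_on_mult smooth_on_subset[OF assms(3)]) auto
  moreover have "smooth_on (- C) (\<lambda>t. \<eta> t * f t)"
    by (rule smooth_on_cong[OF _ _ smooth_on_const[of _ 0]]) (use assms in auto)
  ultimately have "smooth_on (U \<union> - C) (\<lambda>t. \<eta> t * f t)" by (rule smooth_on_Un)
  moreover have "U \<union> - C = UNIV" using assms by auto
  ultimately show ?thesis by simp
qed


section \<open>Fields of the symmetry algebra and their pushforwards\<close>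

lemma funpow_deriv_cmult:
  assumes "open U" "smooth_on U f" "t \<in> U"
  shows "(deriv ^^ n) (\<lambda>t. c * f t) t = c * (deriv ^^ n) f t"
  using assms(3)
proof (induction n arbitrary: t)
  case (Suc n)
  have "(deriv ^^ Suc n) (\<lambda>t. c * f t) t = deriv (\<lambda>t. c * (deriv ^^ n) f t) t"
    using deriv_cong_open[OF \<open>open U\<close> Suc.IH Suc.prems] by simp
  also have "\<dots> = c * (deriv ^^ Suc n) f t"
    by (rule DERIV_imp_deriv[OF DERIV_cmult[OF smooth_on_DERIV_funpow[OF assms(2) Suc.prems]]])
  finally show ?case .
qed simp

lemma funpow_deriv_const: "(deriv ^^ Suc n) (\<lambda>_. c :: real) = (\<lambda>_. 0)"
  by (induction n) auto

lemma deriv_const_simps [simp]: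
  "(deriv ^^ 2) (\<lambda>_. c :: real) = (\<lambda>_. 0)" "(deriv ^^ 3) (\<lambda>_. c :: real) = (\<lambda>_. 0)"
  using funpow_deriv_const[of 1 c] funpow_deriv_const[of 2 c]
  by (simp_all add: numeral_2_eq_2 numeral_3_eq_3)

definition zk_field :: "real \<Rightarrow> (real \<Rightarrow> real) \<Rightarrow> (real \<Rightarrow> real) \<Rightarrow> (real \<Rightarrow> real) \<Rightarrow> vfield" where
  "zk_field k0 g h f = (\<lambda>p. k0 *\<^sub>R V0 p + X g p + Y h p + Z f p)"

lemma zk_field_apply:
  "zk_field k0 g h f (t, x, y, u) =
    (f t,
     2 * k0 * x + g t + y * deriv h t / 2 + (2 * x * deriv f t + y\<^sup>2 * (deriv ^^ 2) f t) / 6,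
     k0 * y + h t + 2 * y * deriv f t / 3,
     2 * k0 * u - deriv g t - y * (deriv ^^ 2) h t / 2
       - (4 * u * deriv f t + 2 * x * (deriv ^^ 2) f t + y\<^sup>2 * (deriv ^^ 3) f t) / 6)"
  by (simp add: zk_field_def V0_def X_def Y_def Z_def field_simps)

lemma zk_algebra_eq:
  "zk_algebra I = {restr I (zk_field k0 g h f) | k0 g h f.
     smooth_on I g \<and> smooth_on I h \<and> smooth_on I f}"
  by (simp add: zk_algebra_def zk_field_def)

lemma mem_cyl [simp]: "p \<in> cyl J \<longleftrightarrow> fst p \<in> J"
  by (cases p) (simp add: cyl_def)

lemma open_cyl: "open J \<Longrightarrow> open (cyl J)"
  by (simp add: cyl_def open_Times)

text \<open>The components contain derivatives up to third order, so agreement of the coefficients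
  is required on an open set around the base point.\<close>

lemma zk_field_cong:
  assumes "open J" "fst p \<in> J"
    and "\<And>t. t \<in> J \<Longrightarrow> g t = g' t" "\<And>t. t \<in> J \<Longrightarrow> h t = h' t" "\<And>t. t \<in> J \<Longrightarrow> f t = f' t"
  shows "zk_field k0 g h f p = zk_field k0 g' h' f' p"
proof -
  obtain t x y u where p: "p = (t, x, y, u)" by (metis prod_cases4)
  then have "t \<in> J" using assms(2) by simp
  then show ?thesis using assms(3-5)
      deriv_cong_open[OF assms(1,3)] deriv_cong_open[OF assms(1,4)] deriv_cong_open[OF assms(1,5)]
      funpow_deriv_cong[OF assms(1,4)] funpow_deriv_cong[OF assms(1,5)]
    by (simp add: p zk_field_apply)
qed

lemma restr_cong: "(\<And>p. fst p \<in> J \<Longrightarrow> v p = w p) \<Longrightarrow> restr J v = restr J w"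
  by (auto simp: restr_def)

lemma zk_field_scale:
  assumes "open J" "fst p \<in> J" "smooth_on J g" "smooth_on J h" "smooth_on J f"
  shows "zk_field (c * k0) (\<lambda>t. c * g t) (\<lambda>t. c * h t) (\<lambda>t. c * f t) p = c *\<^sub>R zk_field k0 g h f p"
proof -
  obtain t x y u where p: "p = (t, x, y, u)" by (metis prod_cases4)
  then have t: "t \<in> J" using assms(2) by simp
  have d: "(deriv ^^ n) (\<lambda>t. c * k t) t = c * (deriv ^^ n) k t" if "smooth_on J k" for n k
    by (rule funpow_deriv_cmult[OF assms(1) that t])
  have d1: "deriv (\<lambda>t. c * k t) t = c * deriv k t" if "smooth_on J k" for k
    using d[OF that, of 1] by simp
  show ?thesis using assms(3-5)
    by (simp add: p zk_field_apply d d1 algebra_simps add_divide_distrib diff_divide_distrib)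
qed

lemma X_eq: "X g = zk_field 0 g (\<lambda>_. 0) (\<lambda>_. 0)"
  and Y_eq: "Y h = zk_field 0 (\<lambda>_. 0) h (\<lambda>_. 0)"
  and V0_eq: "V0 = zk_field 1 (\<lambda>_. 0) (\<lambda>_. 0) (\<lambda>_. 0)"
  by (auto simp: fun_eq_iff zk_field_apply X_def Y_def V0_def)

lemma V0_Z1_eq: "(\<lambda>p. k0 *\<^sub>R V0 p + Z (\<lambda>t. 1) p) = zk_field k0 (\<lambda>_. 0) (\<lambda>_. 0) (\<lambda>_. 1)"
  by (auto simp: fun_eq_iff zk_field_apply Z_def V0_def)

section \<open>Derivatives and pushforwards along one flow map\<close>

lemma has_vector_derivative_has_derivative_compose:
  assumes "(f has_vector_derivative f') (at x)" "(g has_derivative g') (at (f x))"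
  shows "((\<lambda>r. g (f r)) has_vector_derivative g' f') (at x)"
  using vector_derivative_diff_chain_within[OF assms(1) has_derivative_at_withinI[OF assms(2)]]
  by (simp add: o_def)

lemma frechet_derivative_eq_line:
  assumes "f differentiable (at p)"
    and "((\<lambda>r. f (p + r *\<^sub>R d)) has_vector_derivative D) (at 0)"
  shows "frechet_derivative f (at p) d = D"
proof -
  have "((\<lambda>r. p + r *\<^sub>R d) has_vector_derivative d) (at 0)"
    by (auto intro!: derivative_eq_intros)
  moreover have "(f has_derivative frechet_derivative f (at p)) (at (p + 0 *\<^sub>R d))"
    using assms(1) by (simp add: frechet_derivative_works)
  ultimately have "((\<lambda>r. f (p + r *\<^sub>R d)) has_vector_derivative frechet_derivative f (at p) d) (at 0)"
    by (rule has_vector_derivative_has_derivative_compose)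
  then show ?thesis using assms(2) vector_derivative_unique_at by blast
qed

text \<open>Injectivity lets \<open>inv_into\<close> recover the preimage, so the pushforward is
  determined by checking that \<open>v\<close> and \<open>w\<close> are \<phi>-related at source
  points.\<close>

lemma pushforward_restr:
  fixes \<phi> :: "point \<Rightarrow> point"
  assumes "inj_on \<phi> (cyl J)" "\<phi> ` cyl J = cyl J'"
    and "\<And>p. fst p \<in> J \<Longrightarrow> frechet_derivative \<phi> (at p) (v p) = w (\<phi> p)"
  shows "pushforward J J' \<phi> (restr J v) = restr J' w"
  unfolding pushforward_def
proof (rule restr_cong)
  fix q :: point assume "fst q \<in> J'"
  then have "q \<in> \<phi> ` cyl J" using assms(2) by simp
  then obtain p where "p \<in> cyl J" "q = \<phi> p" by blast
  then show "(let p = inv_into (cyl J) \<phi> q in frechet_derivative \<phi> (at p) (restr J v p)) = w q"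
    using assms(1,3) by (simp add: restr_def)
qed

lemma Ad_G_step:
  assumes "Ad_G J B J' A" "A v = restr J' w"
    and "open_interval K" "V \<in> zk_algebra K" "local_flow K V J' \<epsilon> \<Phi>"
    and "open_interval J''" "\<Phi> \<epsilon> ` cyl J' = cyl J''" "inj_on (\<Phi> \<epsilon>) (cyl J')"
    and "\<And>p. fst p \<in> J' \<Longrightarrow> frechet_derivative (\<Phi> \<epsilon>) (at p) (w p) = w' (\<Phi> \<epsilon> p)"
  shows "\<exists>B A. Ad_G J B J'' A \<and> A v = restr J'' w'"
  using Ad_G.Flow[OF assms(1,3-7)] pushforward_restr[OF assms(8,7,9)] assms(2)
  by (metis comp_apply)

lemma Ad_G_codomain: "Ad_G J B J' A \<Longrightarrow> open_interval J'"
  by (induction rule: Ad_G.induct) auto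

lemma local_flow_differentiable:
  assumes "local_flow K V J \<epsilon> \<Phi>" "open J" "fst p \<in> J"
  shows "\<Phi> \<epsilon> differentiable (at p)"
proof -
  have "\<Phi> \<epsilon> differentiable_on cyl J" using assms(1) by (auto simp: local_flow_def)
  then show ?thesis
    using differentiable_on_eq_differentiable_at[OF open_cyl[OF assms(2)], of "\<Phi> \<epsilon>"] assms(3)
    by simp
qed

lemma pushforward_scale:
  fixes \<phi> :: "point \<Rightarrow> point"
  assumes "\<phi> ` cyl J = cyl J'" "\<And>p. fst p \<in> J \<Longrightarrow> \<phi> differentiable (at p)"
  shows "pushforward J J' \<phi> (\<lambda>p. c *\<^sub>R v p) = (\<lambda>q. c *\<^sub>R pushforward J J' \<phi> v q)"
proof
  fix q
  show "pushforward J J' \<phi> (\<lambda>p. c *\<^sub>R v p) q = c *\<^sub>R pushforward J J' \<phi> v q"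
  proof (cases "q \<in> cyl J'")
    case True
    then have "inv_into (cyl J) \<phi> q \<in> cyl J" using assms(1) by (metis inv_into_into)
    then have "\<phi> differentiable (at (inv_into (cyl J) \<phi> q))" using assms(2) by simp
    then have "linear (frechet_derivative \<phi> (at (inv_into (cyl J) \<phi> q)))"
      by (rule linear_frechet_derivative)
    then show ?thesis using True
      by (simp add: pushforward_def restr_def Let_def linear_scale)
  qed (simp add: pushforward_def restr_def)
qed

text \<open>Linearity of the derivative at each point; this is where the differentiability clause of
  \<open>local_flow\<close> enters. Homogeneity is the part that concerns spans of a single
  field.\<close>

lemma Ad_G_scale:
  assumes "Ad_G J B J' A" shows "A (\<lambda>p. c *\<^sub>R v p) = (\<lambda>q. c *\<^sub>R A v q)"
  using assms
proof (induction rule: Ad_G.induct)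
  case (Flow J B J' A K V \<epsilon> \<Phi> J'')
  then show ?case
    using pushforward_scale[of "\<Phi> \<epsilon>" J' J''] local_flow_differentiable Ad_G_codomain
    by (simp add: open_interval_def)
qed simp

lemma vf_span_singleton: "vf_span {v} = (\<lambda>c p. c *\<^sub>R v p) ` UNIV"
  by (rule vf.span_singleton)

lemma Ad_G_span:
  assumes "Ad_G J B J' A" shows "A ` vf_span {v} = vf_span {A v}"
  unfolding vf_span_singleton image_image by (simp add: Ad_G_scale[OF assms])

text \<open>When \<open>\<Theta>\<close> turns the constant field \<open>e\<close> into
  \<open>W\<close>, the flow of \<open>W\<close> is translation along \<open>e\<close> seen through
  \<open>\<Theta>\<close>. The derivative along the line is assumed at parameter 0 only, but for
  every \<open>q\<close>, so it can be restarted at parameter \<open>s\<close>.\<close>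

lemma conjugate_shift_local_flow:
  fixes \<Theta> \<Lambda> :: "point \<Rightarrow> point"
  assumes "\<And>q. \<Theta> differentiable (at q)" "\<And>p. \<Lambda> differentiable (at p)" "\<And>p. \<Theta> (\<Lambda> p) = p"
    and line: "\<And>q. ((\<lambda>r. \<Theta> (q + r *\<^sub>R e)) has_vector_derivative W (\<Theta> q)) (at 0)"
  shows "local_flow UNIV W J \<epsilon> (\<lambda>s p. \<Theta> (\<Lambda> p + s *\<^sub>R e))"
  unfolding local_flow_def
proof (intro ballI conjI)
  fix p s
  have "((\<lambda>r. r - s) has_vector_derivative 1) (at s)"
    by (auto intro!: derivative_eq_intros)
  from vector_diff_chain_at[OF this, of "\<lambda>r. \<Theta> (\<Lambda> p + s *\<^sub>R e + r *\<^sub>R e)"]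
  have "((\<lambda>r. \<Theta> (\<Lambda> p + r *\<^sub>R e)) has_vector_derivative W (\<Theta> (\<Lambda> p + s *\<^sub>R e))) (at s)"
    using line[of "\<Lambda> p + s *\<^sub>R e"] by (simp add: o_def algebra_simps)
  then show "((\<lambda>r. \<Theta> (\<Lambda> p + r *\<^sub>R e)) has_vector_derivative W (\<Theta> (\<Lambda> p + s *\<^sub>R e)))
      (at s within closed_segment 0 \<epsilon>)"
    by (rule has_vector_derivative_at_within)
next
  fix s
  have "(\<lambda>p. \<Theta> (\<Lambda> p + s *\<^sub>R e)) differentiable (at p)" for p
    using differentiable_chain_at[of "\<lambda>p. \<Lambda> p + s *\<^sub>R e" p \<Theta>] assms(1,2)
    by (simp add: o_def)
  then show "(\<lambda>p. \<Theta> (\<Lambda> p + s *\<^sub>R e)) differentiable_on cyl J"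
    by (simp add: differentiable_at_imp_differentiable_on)
qed (use assms(3) in \<open>auto simp: cyl_def\<close>)

text \<open>Translations preserve every constant field \<open>d\<close>, hence the conjugated map
  preserves its image \<open>V\<close>. Taking \<open>d\<close> along the shift gives invariance of
  the flowing field itself; other directions give the fields commuting with it.\<close>

lemma frechet_derivative_conjugate_shift:
  fixes \<Theta> \<Lambda> :: "point \<Rightarrow> point"
  assumes "\<And>q. \<Theta> differentiable (at q)" "\<And>p. \<Lambda> differentiable (at p)"
    "\<And>p. \<Theta> (\<Lambda> p) = p" "\<And>q. \<Lambda> (\<Theta> q) = q"
    and line: "\<And>q. ((\<lambda>r. \<Theta> (q + r *\<^sub>R d)) has_vector_derivative V (\<Theta> q)) (at 0)"
  shows "frechet_derivative (\<lambda>p. \<Theta> (\<Lambda> p + e)) (at p) (V p) = V (\<Theta> (\<Lambda> p + e))"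
proof -
  let ?\<Phi> = "\<lambda>p. \<Theta> (\<Lambda> p + e)"
  have "?\<Phi> differentiable (at p)"
    using differentiable_chain_at[of "\<lambda>p. \<Lambda> p + e" p \<Theta>] assms(1,2)
    by (simp add: o_def)
  then have "(?\<Phi> has_derivative frechet_derivative ?\<Phi> (at p)) (at (\<Theta> (\<Lambda> p + 0 *\<^sub>R d)))"
    by (simp add: frechet_derivative_works assms(3))
  with line[of "\<Lambda> p"]
  have "((\<lambda>r. ?\<Phi> (\<Theta> (\<Lambda> p + r *\<^sub>R d))) has_vector_derivative
      frechet_derivative ?\<Phi> (at p) (V (\<Theta> (\<Lambda> p)))) (at 0)"
    by (rule has_vector_derivative_has_derivative_compose)
  moreover have "(\<lambda>r. ?\<Phi> (\<Theta> (\<Lambda> p + r *\<^sub>R d))) = (\<lambda>r. \<Theta> ((\<Lambda> p + e) + r *\<^sub>R d))"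
    by (auto simp: assms(4) algebra_simps)
  ultimately show ?thesis
    using line[of "\<Lambda> p + e"] vector_derivative_unique_at assms(3) by metis
qed


lemma coord_differentiable:
  "fst differentiable (at (p :: point))" "(\<lambda>p. fst (snd p)) differentiable (at (p :: point))"
  "(\<lambda>p. fst (snd (snd p))) differentiable (at (p :: point))"
  "(\<lambda>p. snd (snd (snd p))) differentiable (at (p :: point))"
  by (auto intro!: bounded_linear_imp_differentiable bounded_linear_intros)

section \<open>Straightening a field with nonvanishing time component\<close>

text \<open>Integrating \<open>W = k\<^sub>0 v\<^sub>0 + x\<^sub>G + y\<^sub>H + z\<^sub>F\<close> with \<open>\<tau>\<close> as time: first \<open>t = \<theta> \<tau>\<close>, then \<open>y\<close>, \<open>x\<close>, \<open>u\<close> solve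
  successive linear equations. Their homogeneous solutions are \<open>e1\<close>, \<open>e2\<close>, \<open>e3\<close>; the inhomogeneous terms are
  polynomials in the integration constants \<open>a\<close> of \<open>x\<close> and \<open>b\<close> of \<open>y\<close>, and \<open>\<beta>\<close>, \<open>p\<^sub>i\<close>, \<open>q\<^sub>i\<close> are
  antiderivatives of the coefficients. The map \<open>\<Theta>\<close> below sends \<open>\<partial>\<^sub>\<tau>\<close> to \<open>W\<close>.\<close>

locale zk_chart =
  fixes k0 :: real and G H F \<theta> T e1 e2 e3 \<beta> p0 p1 p2 q0 q1 q2 q3 :: "real \<Rightarrow> real"
  assumes smooth: "smooth_on UNIV G" "smooth_on UNIV H" "smooth_on UNIV F"
    and \<theta>_T [simp]: "\<And>t. \<theta> (T t) = t" and T_\<theta> [simp]: "\<And>\<tau>. T (\<theta> \<tau>) = \<tau>"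
    and mono: "strict_mono T" "strict_mono \<theta>"
    and T_diff: "\<And>t. T differentiable (at t)"
    and nz [simp]: "\<And>\<tau>. e1 \<tau> \<noteq> 0" "\<And>\<tau>. e2 \<tau> \<noteq> 0" "\<And>\<tau>. e3 \<tau> \<noteq> 0"
    and D\<theta>: "\<And>\<tau>. (\<theta> has_real_derivative F (\<theta> \<tau>)) (at \<tau>)"
    and De1: "\<And>\<tau>. (e1 has_real_derivative (k0 + 2 / 3 * deriv F (\<theta> \<tau>)) * e1 \<tau>) (at \<tau>)"
    and De2: "\<And>\<tau>. (e2 has_real_derivative (2 * k0 + 1 / 3 * deriv F (\<theta> \<tau>)) * e2 \<tau>) (at \<tau>)"
    and De3: "\<And>\<tau>. (e3 has_real_derivative (2 * k0 - 2 / 3 * deriv F (\<theta> \<tau>)) * e3 \<tau>) (at \<tau>)"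
    and D\<beta>: "\<And>\<tau>. (\<beta> has_real_derivative H (\<theta> \<tau>) / e1 \<tau>) (at \<tau>)"
    and Dp0: "\<And>\<tau>. (p0 has_real_derivative
      (G (\<theta> \<tau>) + e1 \<tau> * \<beta> \<tau> * deriv H (\<theta> \<tau>) / 2
        + (e1 \<tau> * \<beta> \<tau>)\<^sup>2 * (deriv ^^ 2) F (\<theta> \<tau>) / 6) / e2 \<tau>) (at \<tau>)"
    and Dp1: "\<And>\<tau>. (p1 has_real_derivative
      (e1 \<tau> * deriv H (\<theta> \<tau>) / 2
        + (e1 \<tau>)\<^sup>2 * \<beta> \<tau> * (deriv ^^ 2) F (\<theta> \<tau>) / 3) / e2 \<tau>) (at \<tau>)"
    and Dp2: "\<And>\<tau>. (p2 has_real_derivative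
      ((e1 \<tau>)\<^sup>2 * (deriv ^^ 2) F (\<theta> \<tau>) / 6) / e2 \<tau>) (at \<tau>)"
    and Dq0: "\<And>\<tau>. (q0 has_real_derivative
      (- deriv G (\<theta> \<tau>) - e1 \<tau> * \<beta> \<tau> * (deriv ^^ 2) H (\<theta> \<tau>) / 2
        - e2 \<tau> * p0 \<tau> * (deriv ^^ 2) F (\<theta> \<tau>) / 3
        - (e1 \<tau> * \<beta> \<tau>)\<^sup>2 * (deriv ^^ 3) F (\<theta> \<tau>) / 6) / e3 \<tau>) (at \<tau>)"
    and Dq1: "\<And>\<tau>. (q1 has_real_derivative
      (- (e1 \<tau> * (deriv ^^ 2) H (\<theta> \<tau>) / 2)
        - e2 \<tau> * p1 \<tau> * (deriv ^^ 2) F (\<theta> \<tau>) / 3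
        - (e1 \<tau>)\<^sup>2 * \<beta> \<tau> * (deriv ^^ 3) F (\<theta> \<tau>) / 3) / e3 \<tau>) (at \<tau>)"
    and Dq2: "\<And>\<tau>. (q2 has_real_derivative
      (- (e2 \<tau> * p2 \<tau> * (deriv ^^ 2) F (\<theta> \<tau>) / 3)
        - (e1 \<tau>)\<^sup>2 * (deriv ^^ 3) F (\<theta> \<tau>) / 6) / e3 \<tau>) (at \<tau>)"
    and Dq3: "\<And>\<tau>. (q3 has_real_derivative
      (- (e2 \<tau> * (deriv ^^ 2) F (\<theta> \<tau>) / 3)) / e3 \<tau>) (at \<tau>)"
begin

text \<open>The polynomials in \<open>b\<close> are quadratic because y enters the x- and
  u-components through y and y^2; \<open>a * q3\<close> appears because x enters the u-component
  linearly.\<close>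

definition \<Theta> :: "point \<Rightarrow> point" where
  "\<Theta> = (\<lambda>(\<tau>, a, b, c).
     (\<theta> \<tau>, e2 \<tau> * (a + p0 \<tau> + b * p1 \<tau> + b\<^sup>2 * p2 \<tau>), e1 \<tau> * (b + \<beta> \<tau>),
      e3 \<tau> * (c + q0 \<tau> + b * q1 \<tau> + b\<^sup>2 * q2 \<tau> + a * q3 \<tau>)))"

definition \<Lambda> :: "point \<Rightarrow> point" where
  "\<Lambda> = (\<lambda>(t, x, y, u).
     let \<tau> = T t;
       b = y / e1 \<tau> - \<beta> \<tau>;
       a = x / e2 \<tau> - p0 \<tau> - b * p1 \<tau> - b\<^sup>2 * p2 \<tau>
     in (\<tau>, a, b, u / e3 \<tau> - q0 \<tau> - b * q1 \<tau> - b\<^sup>2 * q2 \<tau> - a * q3 \<tau>))"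

lemma \<Theta>_\<Lambda>: "\<Theta> (\<Lambda> p) = p"
  by (cases p rule: prod_cases4) (simp add: \<Theta>_def \<Lambda>_def Let_def)

lemma \<Lambda>_\<Theta>: "\<Lambda> (\<Theta> q) = q"
  by (cases q rule: prod_cases4) (simp add: \<Theta>_def \<Lambda>_def Let_def)

lemma coeff_differentiable:
  "e1 differentiable (at \<tau>)" "e2 differentiable (at \<tau>)" "e3 differentiable (at \<tau>)"
  "\<beta> differentiable (at \<tau>)" "p0 differentiable (at \<tau>)" "p1 differentiable (at \<tau>)"
  "p2 differentiable (at \<tau>)" "q0 differentiable (at \<tau>)" "q1 differentiable (at \<tau>)"
  "q2 differentiable (at \<tau>)" "q3 differentiable (at \<tau>)" "\<theta> differentiable (at \<tau>)"
  using De1 De2 De3 D\<beta> Dp0 Dp1 Dp2 Dq0 Dq1 Dq2 Dq3 D\<theta> real_differentiable_def by blast+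

lemma \<Theta>_differentiable: "\<Theta> differentiable (at q)"
proof -
  note [simp] = coeff_differentiable[THEN differentiable_compose[OF _ coord_differentiable(1)]]
    coord_differentiable
  show ?thesis unfolding \<Theta>_def case_prod_beta' by simp
qed

lemma \<Lambda>_differentiable: "\<Lambda> differentiable (at p)"
proof -
  have T: "(\<lambda>p. T (fst p)) differentiable (at (p :: point))"
    by (rule differentiable_compose[OF T_diff coord_differentiable(1)])
  note [simp] = T coeff_differentiable[THEN differentiable_compose[OF _ T]] coord_differentiable
  show ?thesis unfolding \<Lambda>_def case_prod_beta' Let_def by simp
qed

abbreviation "W \<equiv> zk_field k0 G H F"

lemma \<Theta>_flow_line:
  "((\<lambda>r. \<Theta> (q + r *\<^sub>R (1, 0, 0, 0))) has_vector_derivative W (\<Theta> q)) (at 0)"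
proof -
  obtain \<tau> a b c where q: "q = (\<tau>, a, b, c)" by (metis prod_cases4)
  let ?t = "\<theta> \<tau>" and ?x = "e2 \<tau> * (a + p0 \<tau> + b * p1 \<tau> + b\<^sup>2 * p2 \<tau>)"
    and ?y = "e1 \<tau> * (b + \<beta> \<tau>)"
    and ?u = "e3 \<tau> * (c + q0 \<tau> + b * q1 \<tau> + b\<^sup>2 * q2 \<tau> + a * q3 \<tau>)"
  have x: "((\<lambda>s. e2 s * (a + p0 s + b * p1 s + b\<^sup>2 * p2 s)) has_real_derivative
      2 * k0 * ?x + G ?t + ?y * deriv H ?t / 2 +
        (2 * ?x * deriv F ?t + ?y\<^sup>2 * (deriv ^^ 2) F ?t) / 6) (at \<tau>)"
    by (rule De2 Dp0 Dp1 Dp2 DERIV_cong[OF DERIV_mult] DERIV_add DERIV_const DERIV_cmult)+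
       (simp add: field_simps power2_eq_square)
  have y: "((\<lambda>s. e1 s * (b + \<beta> s)) has_real_derivative
      k0 * ?y + H ?t + 2 * ?y * deriv F ?t / 3) (at \<tau>)"
    by (rule De1 D\<beta> DERIV_cong[OF DERIV_mult] DERIV_add DERIV_const DERIV_cmult)+
       (simp add: field_simps)
  have u: "((\<lambda>s. e3 s * (c + q0 s + b * q1 s + b\<^sup>2 * q2 s + a * q3 s)) has_real_derivative
      2 * k0 * ?u - deriv G ?t - ?y * (deriv ^^ 2) H ?t / 2 -
        (4 * ?u * deriv F ?t + 2 * ?x * (deriv ^^ 2) F ?t + ?y\<^sup>2 * (deriv ^^ 3) F ?t) / 6) (at \<tau>)"
    by (rule De3 Dq0 Dq1 Dq2 Dq3 DERIV_cong[OF DERIV_mult] DERIV_add DERIV_const DERIV_cmult)+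
       (simp add: field_simps power2_eq_square)
  have "((\<lambda>s. \<Theta> (s, a, b, c)) has_vector_derivative W (\<Theta> (\<tau>, a, b, c))) (at (\<tau> + 0))"
    using D\<theta>[of \<tau>] x y u
    by (simp add: \<Theta>_def zk_field_apply has_vector_derivative_Pair
        has_real_derivative_iff_has_vector_derivative)
  moreover have "((\<lambda>r. \<tau> + r) has_vector_derivative 1) (at 0)"
    by (auto intro!: derivative_eq_intros)
  ultimately show ?thesis using vector_diff_chain_at[of "\<lambda>r. \<tau> + r" 1 0] by (simp add: o_def q)
qed

definition flow :: "real \<Rightarrow> point \<Rightarrow> point" where
  "flow s p = \<Theta> (\<Lambda> p + s *\<^sub>R (1, 0, 0, 0))"

lemma flow_inverse: "flow s (flow (- s) p) = p"
  by (simp add: flow_def \<Theta>_\<Lambda> \<Lambda>_\<Theta> add.assoc flip: zero_prod_def)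

lemma fst_flow: "fst (flow s p) = \<theta> (T (fst p) + s)"
  by (cases p rule: prod_cases4) (simp add: flow_def \<Theta>_def \<Lambda>_def Let_def)

lemma flow_image: "flow s ` cyl {l<..<r} = cyl {\<theta> (T l + s)<..<\<theta> (T r + s)}"
proof -
  have m: "\<theta> x < \<theta> y \<longleftrightarrow> x < y" "T x < T y \<longleftrightarrow> x < y" for x y
    using mono strict_mono_less by blast+
  have "q \<in> flow s ` cyl {l<..<r}" if "fst q \<in> {\<theta> (T l + s)<..<\<theta> (T r + s)}" for q
  proof
    show "q = flow s (flow (- s) q)" by (simp add: flow_inverse)
    have "T l < T (fst q) - s" "T (fst q) - s < T r"
      using that m(2)[of "\<theta> (T l + s)" "fst q"] m(2)[of "fst q" "\<theta> (T r + s)"] by auto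
    then show "flow (- s) q \<in> cyl {l<..<r}"
      using m(1)[of "T l" "T (fst q) - s"] m(1)[of "T (fst q) - s" "T r"] by (simp add: fst_flow)
  qed
  then show ?thesis by (auto simp: fst_flow m)
qed

text \<open>\<open>V\<close> is the image of a constant field, hence invariant under the flow of
  \<open>W\<close>. Since \<open>w\<close> agrees with \<open>V\<close> on the initial interval and
  \<open>w'\<close> agrees with \<open>V\<close> beyond \<open>m\<close>, flowing far enough carries
  \<open>w\<close> to \<open>w'\<close>, whatever lies in between.\<close>

lemma transport:
  assumes Ad: "Ad_G J B {l<..<r} A" "A v = restr {l<..<r} w" and "l < r"
    and line: "\<And>q. ((\<lambda>r. \<Theta> (q + r *\<^sub>R d)) has_vector_derivative V (\<Theta> q)) (at 0)"
    and w: "\<And>p. fst p \<in> {l<..<r} \<Longrightarrow> w p = V p"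
    and w': "\<And>p. fst p > m \<Longrightarrow> w' p = V p"
  shows "\<exists>J' B A. open_interval J' \<and> Ad_G J B J' A \<and> A v = restr J' w'"
proof -
  \<comment> \<open>This time moves the left end \<open>l\<close> exactly to \<open>m\<close>, so by
    monotonicity the image of the whole interval lies to the right of \<open>m\<close>.\<close>
  define s where "s = T m - T l"
  let ?J = "{\<theta> (T l + s)<..<\<theta> (T r + s)}"
  have "\<theta> (T l + s) < \<theta> (T r + s)" using mono \<open>l < r\<close> by (simp add: strict_mono_less)
  then have J: "open_interval ?J" by (auto simp: open_interval_def is_interval_oo)
  have lm: "\<theta> (T l + s) = m" by (simp add: s_def)
  have "\<exists>B A. Ad_G J B ?J A \<and> A v = restr ?J w'"
  proof (rule Ad_G_step[OF Ad _ _ _ J])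
    show "open_interval UNIV" by (simp add: open_interval_def)
    show "restr UNIV W \<in> zk_algebra UNIV" using smooth by (auto simp: zk_algebra_eq)
    show "local_flow UNIV (restr UNIV W) {l<..<r} s flow"
      unfolding flow_def [abs_def]
      using conjugate_shift_local_flow[OF \<Theta>_differentiable \<Lambda>_differentiable \<Theta>_\<Lambda> \<Theta>_flow_line]
      by (simp add: restr_def)
    show "flow s ` cyl {l<..<r} = cyl ?J" by (rule flow_image)
    show "inj_on (flow s) (cyl {l<..<r})"
      by (rule inj_on_inverseI[where g = "flow (- s)"]) (use flow_inverse[of "- s"] in simp)
    fix p :: point assume p: "fst p \<in> {l<..<r}"
    then have "m < fst (flow s p)"
      using flow_image[of s l r] lm by (metis greaterThanLessThan_iff image_eqI mem_cyl)
    then show "frechet_derivative (flow s) (at p) (w p) = w' (flow s p)"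
      using frechet_derivative_conjugate_shift[OF \<Theta>_differentiable \<Lambda>_differentiable \<Theta>_\<Lambda> \<Lambda>_\<Theta> line]
        w[OF p] w' by (simp add: flow_def [abs_def])
  qed
  then show ?thesis using J by blast
qed

end


section \<open>Existence of straightening charts\<close>

lemma antiderivative_exists:
  fixes f :: "real \<Rightarrow> real"
  assumes "continuous_on UNIV f"
  shows "\<exists>P. \<forall>t. (P has_real_derivative f t) (at t)"
  using einterval_antiderivative[of "-\<infinity>" \<infinity> f] assms
  by (auto simp: has_real_derivative_iff_has_vector_derivative continuous_on_eq_continuous_at)

text \<open>\<open>T\<close> is the travel time, an antiderivative of 1/F, and
  \<open>\<theta>\<close> its inverse. Since F = 1 far to the left and far to the right,
  \<open>T\<close> has slope 1 there, so it is onto and the motion t' = F(t) exists for all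
  time.\<close>

lemma clock_exists:
  assumes "continuous_on UNIV F" "\<And>t. F t > 0"
    and "\<And>t. t \<le> n \<Longrightarrow> F t = 1" "\<And>t. m \<le> t \<Longrightarrow> F t = 1"
  shows "\<exists>T \<theta>. (\<forall>t. \<theta> (T t) = t) \<and> (\<forall>\<tau>. T (\<theta> \<tau>) = \<tau>) \<and> strict_mono T \<and> strict_mono \<theta> \<and>
    (\<forall>t. T differentiable (at t)) \<and> (\<forall>\<tau>. (\<theta> has_real_derivative F (\<theta> \<tau>)) (at \<tau>))"
proof -
  have "continuous_on UNIV (\<lambda>t. inverse (F t))"
    using assms(1,2) by (intro continuous_on_inverse) (auto simp: less_imp_neq[THEN not_sym])
  then obtain T where T: "\<And>t. (T has_real_derivative inverse (F t)) (at t)"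
    using antiderivative_exists by blast
  have mono: "strict_mono T"
  proof (rule strict_monoI)
    fix a b :: real assume "a < b"
    then show "T a < T b"
      by (rule DERIV_pos_imp_increasing) (use T assms(2) in \<open>auto intro!: exI[of _ "inverse (F _)"]\<close>)
  qed
  have lin: "T b - T a = b - a" if "a \<le> b" "b \<le> n \<or> m \<le> a" for a b
  proof (cases "a < b")
    case True
    obtain z where "a < z" "z < b" "T b - T a = (b - a) * inverse (F z)"
      using MVT2[OF True, of T "\<lambda>t. inverse (F t)"] T by blast
    then show ?thesis using assms(3)[of z] assms(4)[of z] that by auto
  qed (use that in simp)
  have cont: "isCont T t" for t using T DERIV_isCont by blast
  have "surj T"
  proof (rule surjI[of _ "\<lambda>y. SOME t. T t = y"])
    fix y
    \<comment> \<open>The order of \<open>n\<close> and \<open>m\<close> is open, but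
      \<open>T\<close> has slope 1 to the right of \<open>k\<close> as well. Moving from
      \<open>n\<close> to the left and from \<open>k\<close> to the right by the distance of the
      respective value of \<open>T\<close> to \<open>y\<close> gives arguments of the intermediate
      value theorem.\<close>
    define k where "k = max n m"
    let ?a = "n - \<bar>y - T n\<bar>" and ?b = "k + \<bar>y - T k\<bar>"
    have "n \<le> k" "m \<le> k" by (auto simp: k_def)
    then have "T ?a \<le> y" "y \<le> T ?b"
      using lin[of ?a n] lin[of k ?b] by (auto simp: abs_if split: if_splits)
    moreover have "?a \<le> ?b" using \<open>n \<le> k\<close> abs_ge_zero[of "y - T n"] abs_ge_zero[of "y - T k"] by linarith
    ultimately have "\<exists>t. T t = y"
      using IVT[of T ?a y ?b] cont by blast
    then show "T (SOME t. T t = y) = y" by (rule someI_ex)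
  qed
  define \<theta> where "\<theta> = inv T"
  have T\<theta>: "T (\<theta> \<tau>) = \<tau>" for \<tau> by (simp add: \<theta>_def \<open>surj T\<close> surj_f_inv_f)
  have \<theta>T: "\<theta> (T t) = t" for t
    by (simp add: \<theta>_def inv_f_f strict_mono_imp_inj_on[OF mono])
  have "strict_mono \<theta>"
    using mono by (metis T\<theta> strict_monoI strict_mono_less)
  moreover have "(\<theta> has_real_derivative F (\<theta> \<tau>)) (at \<tau>)" for \<tau>
  proof -
    have "isCont \<theta> (T (\<theta> \<tau>))" by (rule isCont_inverse_function[of 1]) (auto simp: \<theta>T cont)
    then have "(\<theta> has_real_derivative inverse (inverse (F (\<theta> \<tau>)))) (at \<tau>)"
      using assms(2)[of "\<theta> \<tau>"]
      by (intro DERIV_inverse_function[OF T, of _ _ "\<tau> - 1" "\<tau> + 1"]) (auto simp: T\<theta>)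
    then show ?thesis by simp
  qed
  ultimately show ?thesis using T\<theta> \<theta>T mono T real_differentiable_def by blast
qed

lemma zk_chart_exists:
  assumes smooth: "smooth_on UNIV G" "smooth_on UNIV H" "smooth_on UNIV F"
    and pos: "\<And>t. F t > 0" and "\<And>t. t \<le> n \<Longrightarrow> F t = 1" "\<And>t. m \<le> t \<Longrightarrow> F t = 1"
  shows "\<exists>\<theta> T e1 e2 e3 \<beta> p0 p1 p2 q0 q1 q2 q3.
    zk_chart k0 G H F \<theta> T e1 e2 e3 \<beta> p0 p1 p2 q0 q1 q2 q3"
proof -
  obtain T \<theta> where c: "\<And>t. \<theta> (T t) = t" "\<And>\<tau>. T (\<theta> \<tau>) = \<tau>" "strict_mono T" "strict_mono \<theta>"
    "\<And>t. T differentiable (at t)" and D\<theta>: "\<And>\<tau>. (\<theta> has_real_derivative F (\<theta> \<tau>)) (at \<tau>)"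
    using clock_exists[OF smooth_on_imp_continuous_on[OF smooth(3)] pos assms(5,6), of n m] by auto
  have cont: "continuous_on UNIV (\<lambda>\<tau>. (deriv ^^ k) f (\<theta> \<tau>))" if "smooth_on UNIV f" for f k
    by (rule continuous_on_compose2[OF smooth_on_imp_continuous_on[OF smooth_on_funpow_deriv[OF that]]])
       (use DERIV_continuous_on[OF has_field_derivative_at_within[OF D\<theta>]] in auto)
  note [continuous_intros] = cont[OF smooth(1)] cont[OF smooth(2)] cont[OF smooth(3)]
    cont[OF smooth(1), of 0, simplified] cont[OF smooth(2), of 0, simplified]
    cont[OF smooth(1), of 1, simplified] cont[OF smooth(2), of 1, simplified]
  \<comment> \<open>Since F(\<theta>) has \<tau>-derivative F' F, the factor F(\<theta>)^a exp(j k0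
    \<tau>) has logarithmic derivative j k0 + a F'. The pairs (1, 2/3), (2, 1/3), (2, -2/3) are the
    coefficients of k0 and F' in the y-, x- and u-equations.\<close>
  define e where "e = (\<lambda>(j::real) a \<tau>. exp (j * k0 * \<tau>) * F (\<theta> \<tau>) powr a)"
  have [simp]: "e j a \<tau> \<noteq> 0" for j a \<tau> using pos[of "\<theta> \<tau>"] by (simp add: e_def)
  have De: "(e j a has_real_derivative (j * k0 + a * deriv F (\<theta> \<tau>)) * e j a \<tau>) (at \<tau>)" for j a \<tau>
  proof -
    have "((\<lambda>\<tau>. F (\<theta> \<tau>)) has_real_derivative deriv F (\<theta> \<tau>) * F (\<theta> \<tau>)) (at \<tau>)"
      by (rule DERIV_chain2[OF smooth_on_DERIV[OF smooth(3)] D\<theta>]) simp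
    from DERIV_chain2[OF has_real_derivative_powr[OF pos] this, of a]
    have "((\<lambda>\<tau>. F (\<theta> \<tau>) powr a) has_real_derivative a * deriv F (\<theta> \<tau>) * F (\<theta> \<tau>) powr a) (at \<tau>)"
      using pos[of "\<theta> \<tau>"] by (simp add: powr_diff mult_ac)
    moreover have "((\<lambda>\<tau>. exp (j * k0 * \<tau>)) has_real_derivative j * k0 * exp (j * k0 * \<tau>)) (at \<tau>)"
      by (auto intro!: derivative_eq_intros)
    ultimately show ?thesis unfolding e_def
      by (rule DERIV_cong[OF DERIV_mult[rotated]]) (simp add: algebra_simps)
  qed
  have [continuous_intros]: "continuous_on UNIV (e j a)" for j a
    by (rule DERIV_continuous_on[OF has_field_derivative_at_within[OF De]])
  \<comment> \<open>Continuity of the antiderivative is recorded because \<open>\<beta>\<close> and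
    the p's reappear in later integrands.\<close>
  have ex: "\<exists>P. continuous_on UNIV P \<and> (\<forall>t. (P has_real_derivative f t) (at t))"
    if "continuous_on UNIV f" for f :: "real \<Rightarrow> real"
    using antiderivative_exists[OF that] DERIV_continuous_on[OF has_field_derivative_at_within] by blast
  define e1 e2 e3 where "e1 = e 1 (2/3)" and "e2 = e 2 (1/3)" and "e3 = e 2 (- 2/3)"
  note edefs = e1_def e2_def e3_def
  have [simp]: "e1 \<tau> \<noteq> 0" "e2 \<tau> \<noteq> 0" "e3 \<tau> \<noteq> 0" for \<tau> by (simp_all add: edefs)
  have [continuous_intros]: "continuous_on UNIV e1" "continuous_on UNIV e2" "continuous_on UNIV e3"
    unfolding edefs by (intro continuous_intros)+
  have "\<exists>P. continuous_on UNIV P \<and> (\<forall>\<tau>. (P has_real_derivative H (\<theta> \<tau>) / e1 \<tau>) (at \<tau>))"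
    by (rule ex) (auto intro!: continuous_intros)
  then obtain \<beta> where [continuous_intros]: "continuous_on UNIV \<beta>" and
    D\<beta>: "\<And>\<tau>. (\<beta> has_real_derivative H (\<theta> \<tau>) / e1 \<tau>) (at \<tau>)" by blast
  have "\<exists>P. continuous_on UNIV P \<and> (\<forall>\<tau>. (P has_real_derivative
      (G (\<theta> \<tau>) + e1 \<tau> * \<beta> \<tau> * deriv H (\<theta> \<tau>) / 2
        + (e1 \<tau> * \<beta> \<tau>)\<^sup>2 * (deriv ^^ 2) F (\<theta> \<tau>) / 6) / e2 \<tau>) (at \<tau>))"
    by (rule ex) (auto intro!: continuous_intros)
  then obtain p0 where [continuous_intros]: "continuous_on UNIV p0" and
    Dp0: "\<And>\<tau>. (p0 has_real_derivative
      (G (\<theta> \<tau>) + e1 \<tau> * \<beta> \<tau> * deriv H (\<theta> \<tau>) / 2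
        + (e1 \<tau> * \<beta> \<tau>)\<^sup>2 * (deriv ^^ 2) F (\<theta> \<tau>) / 6) / e2 \<tau>) (at \<tau>)" by blast
  have "\<exists>P. continuous_on UNIV P \<and> (\<forall>\<tau>. (P has_real_derivative
      (e1 \<tau> * deriv H (\<theta> \<tau>) / 2
        + (e1 \<tau>)\<^sup>2 * \<beta> \<tau> * (deriv ^^ 2) F (\<theta> \<tau>) / 3) / e2 \<tau>) (at \<tau>))"
    by (rule ex) (auto intro!: continuous_intros)
  then obtain p1 where [continuous_intros]: "continuous_on UNIV p1" and
    Dp1: "\<And>\<tau>. (p1 has_real_derivative
      (e1 \<tau> * deriv H (\<theta> \<tau>) / 2
        + (e1 \<tau>)\<^sup>2 * \<beta> \<tau> * (deriv ^^ 2) F (\<theta> \<tau>) / 3) / e2 \<tau>) (at \<tau>)" by blast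
  have "\<exists>P. continuous_on UNIV P \<and> (\<forall>\<tau>. (P has_real_derivative
      ((e1 \<tau>)\<^sup>2 * (deriv ^^ 2) F (\<theta> \<tau>) / 6) / e2 \<tau>) (at \<tau>))"
    by (rule ex) (auto intro!: continuous_intros)
  then obtain p2 where [continuous_intros]: "continuous_on UNIV p2" and
    Dp2: "\<And>\<tau>. (p2 has_real_derivative
      ((e1 \<tau>)\<^sup>2 * (deriv ^^ 2) F (\<theta> \<tau>) / 6) / e2 \<tau>) (at \<tau>)" by blast
  have "\<exists>P. continuous_on UNIV P \<and> (\<forall>\<tau>. (P has_real_derivative
      (- deriv G (\<theta> \<tau>) - e1 \<tau> * \<beta> \<tau> * (deriv ^^ 2) H (\<theta> \<tau>) / 2
        - e2 \<tau> * p0 \<tau> * (deriv ^^ 2) F (\<theta> \<tau>) / 3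
        - (e1 \<tau> * \<beta> \<tau>)\<^sup>2 * (deriv ^^ 3) F (\<theta> \<tau>) / 6) / e3 \<tau>) (at \<tau>))"
    by (rule ex) (auto intro!: continuous_intros)
  then obtain q0 where
    Dq0: "\<And>\<tau>. (q0 has_real_derivative
      (- deriv G (\<theta> \<tau>) - e1 \<tau> * \<beta> \<tau> * (deriv ^^ 2) H (\<theta> \<tau>) / 2
        - e2 \<tau> * p0 \<tau> * (deriv ^^ 2) F (\<theta> \<tau>) / 3
        - (e1 \<tau> * \<beta> \<tau>)\<^sup>2 * (deriv ^^ 3) F (\<theta> \<tau>) / 6) / e3 \<tau>) (at \<tau>)" by blast
  have "\<exists>P. continuous_on UNIV P \<and> (\<forall>\<tau>. (P has_real_derivative
      (- (e1 \<tau> * (deriv ^^ 2) H (\<theta> \<tau>) / 2)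
        - e2 \<tau> * p1 \<tau> * (deriv ^^ 2) F (\<theta> \<tau>) / 3
        - (e1 \<tau>)\<^sup>2 * \<beta> \<tau> * (deriv ^^ 3) F (\<theta> \<tau>) / 3) / e3 \<tau>) (at \<tau>))"
    by (rule ex) (auto intro!: continuous_intros)
  then obtain q1 where
    Dq1: "\<And>\<tau>. (q1 has_real_derivative
      (- (e1 \<tau> * (deriv ^^ 2) H (\<theta> \<tau>) / 2)
        - e2 \<tau> * p1 \<tau> * (deriv ^^ 2) F (\<theta> \<tau>) / 3
        - (e1 \<tau>)\<^sup>2 * \<beta> \<tau> * (deriv ^^ 3) F (\<theta> \<tau>) / 3) / e3 \<tau>) (at \<tau>)" by blast
  have "\<exists>P. continuous_on UNIV P \<and> (\<forall>\<tau>. (P has_real_derivative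
      (- (e2 \<tau> * p2 \<tau> * (deriv ^^ 2) F (\<theta> \<tau>) / 3)
        - (e1 \<tau>)\<^sup>2 * (deriv ^^ 3) F (\<theta> \<tau>) / 6) / e3 \<tau>) (at \<tau>))"
    by (rule ex) (auto intro!: continuous_intros)
  then obtain q2 where
    Dq2: "\<And>\<tau>. (q2 has_real_derivative
      (- (e2 \<tau> * p2 \<tau> * (deriv ^^ 2) F (\<theta> \<tau>) / 3)
        - (e1 \<tau>)\<^sup>2 * (deriv ^^ 3) F (\<theta> \<tau>) / 6) / e3 \<tau>) (at \<tau>)" by blast
  have "\<exists>P. continuous_on UNIV P \<and> (\<forall>\<tau>. (P has_real_derivative
      (- (e2 \<tau> * (deriv ^^ 2) F (\<theta> \<tau>) / 3)) / e3 \<tau>) (at \<tau>))"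
    by (rule ex) (auto intro!: continuous_intros)
  then obtain q3 where
    Dq3: "\<And>\<tau>. (q3 has_real_derivative
      (- (e2 \<tau> * (deriv ^^ 2) F (\<theta> \<tau>) / 3)) / e3 \<tau>) (at \<tau>)" by blast
  have "zk_chart k0 G H F \<theta> T e1 e2 e3 \<beta> p0 p1 p2 q0 q1 q2 q3"
  proof
    show "(e1 has_real_derivative (k0 + 2 / 3 * deriv F (\<theta> \<tau>)) * e1 \<tau>) (at \<tau>)"
      "(e2 has_real_derivative (2 * k0 + 1 / 3 * deriv F (\<theta> \<tau>)) * e2 \<tau>) (at \<tau>)"
      "(e3 has_real_derivative (2 * k0 - 2 / 3 * deriv F (\<theta> \<tau>)) * e3 \<tau>) (at \<tau>)" for \<tau>
      using De[of 1 "2/3" \<tau>] De[of 2 "1/3" \<tau>] De[of 2 "- 2/3" \<tau>] by (simp_all add: edefs)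
  qed (use smooth c D\<theta> D\<beta> Dp0 Dp1 Dp2 Dq0 Dq1 Dq2 Dq3 in simp_all)
  then show ?thesis by blast
qed

text \<open>For \<open>W = z\<^sub>F\<close> the chart is explicit in terms of \<open>R = F\<^sup>1\<^sup>/\<^sup>3\<close>.\<close>

lemma pure_zk_chart_exists:
  assumes smooth: "smooth_on UNIV R" and pos: "\<And>t. R t > 0"
    and "\<And>t. t \<le> n \<Longrightarrow> R t = 1" "\<And>t. m \<le> t \<Longrightarrow> R t = 1"
    and FR: "\<And>t. F t = R t ^ 3"
  shows "\<exists>\<theta> T. zk_chart 0 (\<lambda>_. 0) (\<lambda>_. 0) F \<theta> T
    (\<lambda>\<tau>. (R (\<theta> \<tau>))\<^sup>2) (\<lambda>\<tau>. R (\<theta> \<tau>)) (\<lambda>\<tau>. inverse ((R (\<theta> \<tau>))\<^sup>2))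
    (\<lambda>_. 0) (\<lambda>_. 0) (\<lambda>_. 0) (\<lambda>\<tau>. deriv F (\<theta> \<tau>) / 6)
    (\<lambda>_. 0) (\<lambda>_. 0) (\<lambda>\<tau>. (deriv F (\<theta> \<tau>))\<^sup>2 / 18 - F (\<theta> \<tau>) * (deriv ^^ 2) F (\<theta> \<tau>) / 6)
    (\<lambda>\<tau>. - (deriv F (\<theta> \<tau>) / 3))"
proof -
  have F: "smooth_on UNIV F"
    by (rule smooth_on_cong[where g = "\<lambda>t. R t * (R t * R t)"])
       (use smooth in \<open>auto simp: FR power3_eq_cube intro!: smooth_on_mult\<close>)
  obtain T \<theta> where c: "\<And>t. \<theta> (T t) = t" "\<And>\<tau>. T (\<theta> \<tau>) = \<tau>" "strict_mono T" "strict_mono \<theta>"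
    "\<And>t. T differentiable (at t)" and D\<theta>: "\<And>\<tau>. (\<theta> has_real_derivative F (\<theta> \<tau>)) (at \<tau>)"
    using clock_exists[OF smooth_on_imp_continuous_on[OF F], of n m] assms(2-4) FR by auto
  have D: "((\<lambda>\<tau>. f (\<theta> \<tau>)) has_real_derivative f' (\<theta> \<tau>) * F (\<theta> \<tau>)) (at \<tau>)"
    if "\<And>t. (f has_real_derivative f' t) (at t)" for f f' \<tau>
    by (rule DERIV_chain2[OF that D\<theta>])
  note DR = D[OF smooth_on_DERIV[OF smooth UNIV_I]]
  note DF = D[OF smooth_on_DERIV[OF F UNIV_I]]
    D[OF smooth_on_DERIV_2[OF F UNIV_I]] D[OF smooth_on_DERIV_3[OF F UNIV_I]]
  have F': "deriv F t = 3 * (R t)\<^sup>2 * deriv R t" for t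
    unfolding FR [abs_def]
    by (rule DERIV_imp_deriv) (rule derivative_eq_intros smooth_on_DERIV[OF smooth] refl | simp)+
  have nz: "R t \<noteq> 0" for t using pos[of t] by simp
  show ?thesis
  proof (intro exI, unfold_locales)
    fix \<tau>
    show "((\<lambda>\<tau>. (R (\<theta> \<tau>))\<^sup>2) has_real_derivative
        (0 + 2 / 3 * deriv F (\<theta> \<tau>)) * (R (\<theta> \<tau>))\<^sup>2) (at \<tau>)"
      by (rule derivative_eq_intros DR refl)+ (simp add: F'[of "\<theta> \<tau>"] FR[of "\<theta> \<tau>"] eval_nat_numeral)
    show "((\<lambda>\<tau>. R (\<theta> \<tau>)) has_real_derivative
        (2 * 0 + 1 / 3 * deriv F (\<theta> \<tau>)) * R (\<theta> \<tau>)) (at \<tau>)"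
      by (rule DERIV_cong[OF DR]) (simp add: F'[of "\<theta> \<tau>"] FR[of "\<theta> \<tau>"] eval_nat_numeral)
    show "((\<lambda>\<tau>. inverse ((R (\<theta> \<tau>))\<^sup>2)) has_real_derivative
        (2 * 0 - 2 / 3 * deriv F (\<theta> \<tau>)) * inverse ((R (\<theta> \<tau>))\<^sup>2)) (at \<tau>)"
      by (rule derivative_eq_intros DR refl)+
         (use nz in \<open>auto simp: F'[of "\<theta> \<tau>"] FR[of "\<theta> \<tau>"] eval_nat_numeral field_simps\<close>)
    \<comment> \<open>The integrand R^4 F'' / (6 R) is F F'' / 6, an exact \<tau>-derivative because
      F = R^3.\<close>
    show "((\<lambda>\<tau>. deriv F (\<theta> \<tau>) / 6) has_real_derivative
        (((R (\<theta> \<tau>))\<^sup>2)\<^sup>2 * (deriv ^^ 2) F (\<theta> \<tau>) / 6) / R (\<theta> \<tau>)) (at \<tau>)"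
      by (rule derivative_eq_intros DF refl)+
         (use nz in \<open>auto simp: FR[of "\<theta> \<tau>"] eval_nat_numeral\<close>)
    \<comment> \<open>The integrand is -F F' F''/18 - F^2 F'''/6. The term -F F''/6 produces the
      second summand together with -F F' F''/6, and F'^2/18 adds F F' F''/9, which leaves the
      first.\<close>
    show "((\<lambda>\<tau>. (deriv F (\<theta> \<tau>))\<^sup>2 / 18 - F (\<theta> \<tau>) * (deriv ^^ 2) F (\<theta> \<tau>) / 6) has_real_derivative
        (- (R (\<theta> \<tau>) * (deriv F (\<theta> \<tau>) / 6) * (deriv ^^ 2) F (\<theta> \<tau>) / 3) -
         ((R (\<theta> \<tau>))\<^sup>2)\<^sup>2 * (deriv ^^ 3) F (\<theta> \<tau>) / 6) / inverse ((R (\<theta> \<tau>))\<^sup>2)) (at \<tau>)"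
      unfolding power2_eq_square[of "deriv F (\<theta> _)"]
      by (rule DERIV_cong[OF DERIV_diff[OF DERIV_cdivide[OF DERIV_mult[OF DF(2) DF(2)]]
            DERIV_cdivide[OF DERIV_mult[OF DF(1) DF(3)]]]])
         (use nz in \<open>auto simp: FR[of "\<theta> \<tau>"] power2_eq_square power3_eq_cube field_simps\<close>)
    show "((\<lambda>\<tau>. - (deriv F (\<theta> \<tau>) / 3)) has_real_derivative
        - (R (\<theta> \<tau>) * (deriv ^^ 2) F (\<theta> \<tau>) / 3) / inverse ((R (\<theta> \<tau>))\<^sup>2)) (at \<tau>)"
      by (rule DERIV_cong[OF DERIV_minus[OF DERIV_cdivide[OF DF(2)]]])
         (use nz in \<open>auto simp: FR[of "\<theta> \<tau>"] power2_eq_square power3_eq_cube field_simps\<close>)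
  qed (use c D\<theta> F nz smooth_on_const in auto)
qed


section \<open>Normal forms\<close>

lemma extend_positive:
  assumes "open I" "t0 \<in> I" "smooth_on I f" "smooth_on I g" "smooth_on I h" "f t0 > 0"
  obtains r F G H where "r > 0" "{t0 - r<..<t0 + r} \<subseteq> I"
    "smooth_on UNIV F" "smooth_on UNIV G" "smooth_on UNIV H" "\<And>t. F t > 0"
    "\<And>t. t \<in> {t0 - r<..<t0 + r} \<Longrightarrow> F t = f t" "\<And>t. t \<in> {t0 - r<..<t0 + r} \<Longrightarrow> G t = g t"
    "\<And>t. t \<in> {t0 - r<..<t0 + r} \<Longrightarrow> H t = h t"
    "\<And>t. t \<notin> {t0 - 2 * r<..<t0 + 2 * r} \<Longrightarrow> F t = 1 \<and> G t = 0 \<and> H t = 0"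
proof -
  have "open (I \<inter> f -` {0<..})"
    using assms by (intro continuous_open_preimage smooth_on_imp_continuous_on) auto
  then obtain e where e: "e > 0" "cball t0 e \<subseteq> I \<inter> f -` {0<..}"
    using assms open_contains_cball by blast
  \<comment> \<open>The cutoff vanishes from distance 2r on, so 2r = e keeps its support inside the
    ball where \<open>f\<close> is positive.\<close>
  define r where "r = e / 2"
  define C where "C = {t0 - 2 * r..t0 + 2 * r}"
  have r: "r > 0" "C \<subseteq> I" "\<And>t. t \<in> C \<Longrightarrow> f t > 0" "closed C"
    using e by (auto simp: r_def C_def cball_eq_atLeastAtMost)
  obtain \<eta> where \<eta>: "smooth_on UNIV \<eta>" "\<And>t. 0 \<le> \<eta> t" "\<And>t. \<eta> t \<le> 1"
    "\<And>t. \<bar>t - t0\<bar> < r \<Longrightarrow> \<eta> t = 1" and \<eta>0: "\<And>t. \<bar>t - t0\<bar> \<ge> 2 * r \<Longrightarrow> \<eta> t = 0"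
    using smooth_cutoff[OF r(1)] by metis
  have out: "\<eta> t = 0" if "t \<notin> C" for t using that by (intro \<eta>0) (auto simp: C_def)
  have ext: "smooth_on UNIV (\<lambda>t. \<eta> t * k t)" if "smooth_on I k" for k
    by (rule smooth_on_cutoff_mult[OF \<open>open I\<close> that \<eta>(1) r(4,2) out])
  \<comment> \<open>A convex combination of \<open>f\<close> and 1, so positivity survives the
    extension.\<close>
  have F: "smooth_on UNIV (\<lambda>t. \<eta> t * f t + (1 - \<eta> t))"
    by (intro smooth_on_add smooth_on_diff smooth_on_const ext assms \<eta> open_UNIV)
  have pos: "\<eta> t * f t + (1 - \<eta> t) > 0" for t
  proof (cases "t \<in> C")
    case True
    then show ?thesis using r(3)[OF True] \<eta>(2,3)[of t]
      by (cases "\<eta> t = 1") (auto intro!: add_nonneg_pos)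
  qed (simp add: out)
  have one: "\<eta> t = 1" if "t \<in> {t0 - r<..<t0 + r}" for t using that \<eta>(4)[of t] by auto
  show ?thesis
    by (rule that[OF r(1) _ F ext[OF assms(4)] ext[OF assms(5)] pos])
       (use r(1,2) \<eta>0 one in \<open>auto simp: C_def abs_if\<close>)
qed

text \<open>\<open>J\<close> realises the permitted shrinking in t. \<open>J'\<close> is unrelated
  to \<open>I\<close>, because the flow of an extended field carries the interval away from where
  \<open>v\<close> was given.\<close>

definition normalizes :: "real set \<Rightarrow> vfield \<Rightarrow> vfield \<Rightarrow> bool" where
  "normalizes I v w \<longleftrightarrow> (\<exists>J J' B A. open_interval J \<and> J \<subseteq> I \<and> open_interval J' \<and>
     Ad_G J B J' A \<and> A (restr J v) = restr J' w)"

lemma open_interval_Ioo: "a < b \<Longrightarrow> open_interval {a<..<b}"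
  by (auto simp: open_interval_def is_interval_oo)

lemma normalizes_zk_field_Z:
  assumes "open_interval I" "t0 \<in> I" "smooth_on I g" "smooth_on I h" "smooth_on I f" "f t0 > 0"
  shows "normalizes I (zk_field k0 g h f) (zk_field k0 (\<lambda>_. 0) (\<lambda>_. 0) (\<lambda>_. 1))"
proof -
  have "open I" using assms by (simp add: open_interval_def)
  obtain r F G H where r: "r > 0" "{t0 - r<..<t0 + r} \<subseteq> I"
    and sm: "smooth_on UNIV F" "smooth_on UNIV G" "smooth_on UNIV H" "\<And>t. F t > 0"
    and eq: "\<And>t. t \<in> {t0 - r<..<t0 + r} \<Longrightarrow> F t = f t" "\<And>t. t \<in> {t0 - r<..<t0 + r} \<Longrightarrow> G t = g t"
      "\<And>t. t \<in> {t0 - r<..<t0 + r} \<Longrightarrow> H t = h t"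
    and out: "\<And>t. t \<notin> {t0 - 2 * r<..<t0 + 2 * r} \<Longrightarrow> F t = 1 \<and> G t = 0 \<and> H t = 0"
    by (rule extend_positive[OF \<open>open I\<close> assms(2,5,3,4,6)]) (rule that)
  obtain \<theta> T e1 e2 e3 \<beta> p0 p1 p2 q0 q1 q2 q3 where
    "zk_chart k0 G H F \<theta> T e1 e2 e3 \<beta> p0 p1 p2 q0 q1 q2 q3"
    using zk_chart_exists[OF sm(2,3,1,4), of "t0 - 2 * r" "t0 + 2 * r" k0] out by force
  then interpret zk_chart k0 G H F \<theta> T e1 e2 e3 \<beta> p0 p1 p2 q0 q1 q2 q3 .
  let ?J = "{t0 - r<..<t0 + r}"
  have J: "open_interval ?J" using r by (simp add: open_interval_Ioo)
  have "\<exists>J' B A. open_interval J' \<and> Ad_G ?J B J' A \<and>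
      A (restr ?J (zk_field k0 g h f)) = restr J' (zk_field k0 (\<lambda>_. 0) (\<lambda>_. 0) (\<lambda>_. 1))"
  proof (rule transport[OF Ad_G.Id[OF J] _ _ \<Theta>_flow_line])
    show "zk_field k0 g h f p = zk_field k0 G H F p" if "fst p \<in> ?J" for p
      by (rule zk_field_cong[OF _ that]) (simp_all add: eq)
    show "zk_field k0 (\<lambda>_. 0) (\<lambda>_. 0) (\<lambda>_. 1) p = zk_field k0 G H F p"
      if "fst p > t0 + 2 * r" for p
      by (rule zk_field_cong[of "{t0 + 2 * r<..}"]) (use that out in auto)
  qed (use r in simp_all)
  then show ?thesis unfolding normalizes_def using J r(2) by blast
qed

lemma funpow_deriv_2: "(deriv ^^ 2) f = deriv (deriv f)"
  by (simp add: numeral_2_eq_2)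

lemma deriv_square:
  assumes "smooth_on UNIV R"
  shows "deriv (\<lambda>t. (R t)\<^sup>2) t = 2 * R t * deriv R t"
    and "(deriv ^^ 2) (\<lambda>t. (R t)\<^sup>2) t = 2 * (deriv R t)\<^sup>2 + 2 * R t * (deriv ^^ 2) R t"
proof -
  note D = smooth_on_DERIV[OF assms UNIV_I] smooth_on_DERIV_2[OF assms UNIV_I]
  have 1: "deriv (\<lambda>t. (R t)\<^sup>2) = (\<lambda>t. 2 * R t * deriv R t)"
    by (rule ext, rule DERIV_imp_deriv) (rule derivative_eq_intros D refl | simp)+
  then show "deriv (\<lambda>t. (R t)\<^sup>2) t = 2 * R t * deriv R t" by simp
  show "(deriv ^^ 2) (\<lambda>t. (R t)\<^sup>2) t = 2 * (deriv R t)\<^sup>2 + 2 * R t * (deriv ^^ 2) R t"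
    unfolding funpow_deriv_2[of "\<lambda>t. (R t)\<^sup>2"] 1
    by (rule DERIV_imp_deriv, (rule derivative_eq_intros D refl)+) (simp add: power2_eq_square)
qed

lemma deriv_cube:
  assumes "smooth_on UNIV R"
  shows "deriv (\<lambda>t. R t ^ 3) t = 3 * (R t)\<^sup>2 * deriv R t"
    and "(deriv ^^ 2) (\<lambda>t. R t ^ 3) t = 6 * R t * (deriv R t)\<^sup>2 + 3 * (R t)\<^sup>2 * (deriv ^^ 2) R t"
proof -
  note D = smooth_on_DERIV[OF assms UNIV_I] smooth_on_DERIV_2[OF assms UNIV_I]
  have 1: "deriv (\<lambda>t. R t ^ 3) = (\<lambda>t. 3 * (R t * R t) * deriv R t)"
    by (rule ext, rule DERIV_imp_deriv) (rule derivative_eq_intros D refl | simp add: power2_eq_square)+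
  then show "deriv (\<lambda>t. R t ^ 3) t = 3 * (R t)\<^sup>2 * deriv R t" by (simp add: power2_eq_square)
  show "(deriv ^^ 2) (\<lambda>t. R t ^ 3) t =
      6 * R t * (deriv R t)\<^sup>2 + 3 * (R t)\<^sup>2 * (deriv ^^ 2) R t"
    unfolding funpow_deriv_2[of "\<lambda>t. R t ^ 3"] 1
    by (rule DERIV_imp_deriv, (rule derivative_eq_intros D refl)+)
       (simp add: power2_eq_square algebra_simps)
qed

text \<open>In the chart of z_F the two candidates for \<open>V\<close> are the coordinate fields of
  \<open>a\<close> and \<open>b\<close>: their leading coefficients R and R^2 are the scale factors
  of x and y, and the polynomial corrections of the chart reproduce the remaining
  components.\<close>

lemma pure_zk_chart_transport:
  assumes R: "smooth_on UNIV R" "\<And>t. R t > 0"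
    "\<And>t. t \<notin> {n<..<m} \<Longrightarrow> R t = 1"
    and Ad: "Ad_G J B {l<..<r} A" "A v = restr {l<..<r} w" "l < r"
    and V: "V = zk_field 0 R (\<lambda>_. 0) (\<lambda>_. 0) \<or> V = zk_field 0 (\<lambda>_. 0) (\<lambda>t. (R t)\<^sup>2) (\<lambda>_. 0)"
    and w: "\<And>p. fst p \<in> {l<..<r} \<Longrightarrow> w p = V p"
    and w': "\<And>p. fst p > m \<Longrightarrow> w' p = V p"
  shows "\<exists>J' B A. open_interval J' \<and> Ad_G J B J' A \<and> A v = restr J' w'"
proof -
  define F where "F = (\<lambda>t. R t ^ 3)"
  obtain \<theta> T where "zk_chart 0 (\<lambda>_. 0) (\<lambda>_. 0) F \<theta> T
    (\<lambda>\<tau>. (R (\<theta> \<tau>))\<^sup>2) (\<lambda>\<tau>. R (\<theta> \<tau>)) (\<lambda>\<tau>. inverse ((R (\<theta> \<tau>))\<^sup>2))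
    (\<lambda>_. 0) (\<lambda>_. 0) (\<lambda>_. 0) (\<lambda>\<tau>. deriv F (\<theta> \<tau>) / 6)
    (\<lambda>_. 0) (\<lambda>_. 0) (\<lambda>\<tau>. (deriv F (\<theta> \<tau>))\<^sup>2 / 18 - F (\<theta> \<tau>) * (deriv ^^ 2) F (\<theta> \<tau>) / 6)
    (\<lambda>\<tau>. - (deriv F (\<theta> \<tau>) / 3))"
    using pure_zk_chart_exists[OF R(1,2), of n m F] R(3) unfolding F_def by force
  then interpret zk_chart 0 "\<lambda>_. 0" "\<lambda>_. 0" F \<theta> T
    "\<lambda>\<tau>. (R (\<theta> \<tau>))\<^sup>2" "\<lambda>\<tau>. R (\<theta> \<tau>)" "\<lambda>\<tau>. inverse ((R (\<theta> \<tau>))\<^sup>2)"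
    "\<lambda>_. 0" "\<lambda>_. 0" "\<lambda>_. 0" "\<lambda>\<tau>. deriv F (\<theta> \<tau>) / 6"
    "\<lambda>_. 0" "\<lambda>_. 0" "\<lambda>\<tau>. (deriv F (\<theta> \<tau>))\<^sup>2 / 18 - F (\<theta> \<tau>) * (deriv ^^ 2) F (\<theta> \<tau>) / 6"
    "\<lambda>\<tau>. - (deriv F (\<theta> \<tau>) / 3)" .
  have nz: "R t \<noteq> 0" for t using R(2)[of t] by simp
  have FR: "F t = R t ^ 3" for t by (simp add: F_def)
  note dF = deriv_cube[OF R(1), folded F_def]
  from V show ?thesis
  proof
    assume V: "V = zk_field 0 R (\<lambda>_. 0) (\<lambda>_. 0)"
    have "((\<lambda>r. \<Theta> (q + r *\<^sub>R (0, 1, 0, 0))) has_vector_derivative V (\<Theta> q)) (at 0)" for q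
    proof -
      obtain \<tau> a b c where q: "q = (\<tau>, a, b, c)" by (metis prod_cases4)
      have "((\<lambda>r. A * (a + r + k)) has_real_derivative A) (at 0)" for A k :: real
        by (auto intro!: derivative_eq_intros)
      moreover have "((\<lambda>r. A * (c + k + (a + r) * - l)) has_real_derivative - (A * l)) (at 0)"
        for A k l :: real
        by (auto intro!: derivative_eq_intros)
      \<comment> \<open>F' = 3 R^2 R' turns F'/(3 R^2) into R', so the slope is the u-component of
        x_R.\<close>
      then have "((\<lambda>r. inverse ((R (\<theta> \<tau>))\<^sup>2) * (c + k + (a + r) * - (deriv F (\<theta> \<tau>) / 3)))
          has_real_derivative - deriv R (\<theta> \<tau>)) (at 0)" for k
        by (rule DERIV_cong) (use nz[of "\<theta> \<tau>"] in \<open>simp add: dF\<close>)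
      ultimately show ?thesis
        by (simp add: q V \<Theta>_def zk_field_apply has_vector_derivative_Pair
            has_real_derivative_iff_has_vector_derivative)
    qed
    from transport[where V = V and d = "(0, 1, 0, 0)"
        and A = A and v = v and w = w and m = m and w' = w', OF Ad this w w']
    show ?thesis by this
  next
    assume V: "V = zk_field 0 (\<lambda>_. 0) (\<lambda>t. (R t)\<^sup>2) (\<lambda>_. 0)"
    have "((\<lambda>r. \<Theta> (q + r *\<^sub>R (0, 0, 1, 0))) has_vector_derivative V (\<Theta> q)) (at 0)" for q
    proof -
      obtain \<tau> a b c where q: "q = (\<tau>, a, b, c)" by (metis prod_cases4)
      let ?t = "\<theta> \<tau>"
      let ?h2 = "2 * (deriv R ?t)\<^sup>2 + 2 * R ?t * (deriv ^^ 2) R ?t"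
      have 1: "((\<lambda>r. A * (a + (b + r)\<^sup>2 * k)) has_real_derivative A * (2 * b * k)) (at 0)"
        for A k a :: real
        by (rule derivative_eq_intros refl | simp)+
      then have "((\<lambda>r. R ?t * (a + (b + r)\<^sup>2 * (deriv F ?t / 6))) has_real_derivative
          (R ?t)\<^sup>2 * b * (2 * R ?t * deriv R ?t) / 2) (at 0)"
        by (rule DERIV_cong) (simp add: dF power2_eq_square)
      moreover have "((\<lambda>r. A * (b + r)) has_real_derivative A) (at 0)" for A :: real
        by (auto intro!: derivative_eq_intros)
      moreover have "((\<lambda>r. A * (c + (b + r)\<^sup>2 * k + l)) has_real_derivative A * (2 * b * k)) (at 0)"
        for A k l :: real
        using 1[of A "c + l" k] by (simp add: algebra_simps)
      \<comment> \<open>In terms of R the quadratic coefficient is -R^4 (R'^2 + R R'')/2, while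
        (R^2)'' = 2 (R'^2 + R R''); this matches the u-component of y_h for h = R^2.\<close>
      then have "((\<lambda>r. inverse ((R ?t)\<^sup>2) * (c + (b + r)\<^sup>2 *
          ((deriv F ?t)\<^sup>2 / 18 - F ?t * (deriv ^^ 2) F ?t / 6) + a * - (deriv F ?t / 3)))
          has_real_derivative - ((R ?t)\<^sup>2 * b * ?h2) / 2) (at 0)"
        by (rule DERIV_cong) (use nz[of ?t] in
            \<open>simp add: dF FR[of ?t] power2_eq_square power3_eq_cube field_simps\<close>)
      ultimately show ?thesis
        by (simp add: q V \<Theta>_def zk_field_apply has_vector_derivative_Pair deriv_square[OF R(1)]
            has_real_derivative_iff_has_vector_derivative)
    qed
    from transport[where V = V and d = "(0, 0, 1, 0)"
        and A = A and v = v and w = w and m = m and w' = w', OF Ad this w w']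
    show ?thesis by this
  qed
qed

text \<open>The flow of \<open>x\<^sub>g + y\<^sub>h\<close>.\<close>

definition shear :: "(real \<Rightarrow> real) \<Rightarrow> (real \<Rightarrow> real) \<Rightarrow> real \<Rightarrow> point \<Rightarrow> point" where
  "shear g h s = (\<lambda>(t, x, y, u).
     (t, x + s * (g t + y * deriv h t / 2) + s\<^sup>2 * (h t * deriv h t / 4), y + s * h t,
      u - s * (deriv g t + y * (deriv ^^ 2) h t / 2) - s\<^sup>2 * (h t * (deriv ^^ 2) h t / 4)))"

lemma shear_inverse: "shear g h s (shear g h (- s) p) = p"
  by (cases p rule: prod_cases4) (simp add: shear_def field_simps power2_eq_square)

lemma shear_inj: "inj_on (shear g h s) S"
  by (rule inj_on_inverseI[where g = "shear g h (- s)"]) (use shear_inverse[of g h "- s"] in simp)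

lemma shear_image: "shear g h s ` cyl J = cyl J"
proof -
  have fst: "fst (shear g h s p) = fst p" for s p
    by (cases p rule: prod_cases4) (simp add: shear_def)
  have "p \<in> shear g h s ` cyl J" if "fst p \<in> J" for p
    by (rule image_eqI[of _ _ "shear g h (- s) p"]) (use that in \<open>simp_all add: shear_inverse fst\<close>)
  then show ?thesis by (auto simp: fst)
qed

lemma shear_differentiable:
  assumes "smooth_on K g" "smooth_on K h" "fst p \<in> K"
  shows "shear g h s differentiable (at p)"
proof -
  have d: "(\<lambda>p. (deriv ^^ n) f (fst p)) differentiable (at p)" if "smooth_on K f" for f n
    by (rule differentiable_compose[OF _ coord_differentiable(1)]) (use that assms(3) in \<open>auto simp: smooth_on_def\<close>)
  note [simp] = coord_differentiable d[OF assms(2), of 2] d[OF assms(1), of 0, simplified]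
    d[OF assms(1), of 1, simplified] d[OF assms(2), of 0, simplified] d[OF assms(2), of 1, simplified]
  show ?thesis unfolding shear_def case_prod_beta' by simp
qed

lemma shear_local_flow:
  assumes "open_interval K" "smooth_on K g" "smooth_on K h" "J \<subseteq> K"
  shows "local_flow K (restr K (zk_field 0 g h (\<lambda>_. 0))) J \<epsilon> (shear g h)"
  unfolding local_flow_def
proof (intro ballI conjI)
  fix p s assume "p \<in> cyl J"
  then have K: "fst p \<in> K" using assms by auto
  obtain t x y u where p: "p = (t, x, y, u)" by (metis prod_cases4)
  show "shear g h 0 p = p" by (simp add: p shear_def)
  show "shear g h s p \<in> cyl K" using K by (simp add: p shear_def)
  have x: "((\<lambda>s. x + s * (g t + y * deriv h t / 2) + s\<^sup>2 * (h t * deriv h t / 4)) has_real_derivative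
      g t + (y + s * h t) * deriv h t / 2) (at s)"
    by (auto intro!: derivative_eq_intros simp: field_simps)
  have y: "((\<lambda>s. y + s * h t) has_real_derivative h t) (at s)"
    by (auto intro!: derivative_eq_intros)
  have u: "((\<lambda>s. u - s * (deriv g t + y * (deriv ^^ 2) h t / 2) - s\<^sup>2 * (h t * (deriv ^^ 2) h t / 4))
      has_real_derivative - deriv g t - (y + s * h t) * (deriv ^^ 2) h t / 2) (at s)"
    by (auto intro!: derivative_eq_intros simp: field_simps)
  have "((\<lambda>s. shear g h s p) has_vector_derivative
      zk_field 0 g h (\<lambda>_. 0) (shear g h s p)) (at s)"
    using x y u by (simp add: p shear_def zk_field_apply has_vector_derivative_Pair
        has_real_derivative_iff_has_vector_derivative)
  then show "((\<lambda>r. shear g h r p) has_vector_derivative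
      restr K (zk_field 0 g h (\<lambda>_. 0)) (shear g h s p)) (at s within closed_segment 0 \<epsilon>)"
    using K by (auto simp: restr_def p shear_def intro: has_vector_derivative_at_within)
next
  fix s
  show "shear g h s differentiable_on cyl J"
    using shear_differentiable[OF assms(2,3)] assms(4)
    by (auto intro!: differentiable_at_imp_differentiable_on)
qed

text \<open>Only directions without t-component are treated, which covers all fields with f = 0; in
  these directions the coefficients g, h and their derivatives are constants.\<close>

lemma frechet_derivative_shear:
  assumes "smooth_on K g" "smooth_on K h" "t \<in> K"
  shows "frechet_derivative (shear g h s) (at (t, x, y, u)) (0, a, b, c) =
    (0, a + s * b * deriv h t / 2, b, c - s * b * (deriv ^^ 2) h t / 2)"
proof (rule frechet_derivative_eq_line)
  show "shear g h s differentiable (at (t, x, y, u))"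
    using shear_differentiable[OF assms(1,2)] assms(3) by simp
  have "((\<lambda>r. x + r * a + s * (g t + (y + r * b) * deriv h t / 2) + s\<^sup>2 * (h t * deriv h t / 4))
      has_real_derivative a + s * b * deriv h t / 2) (at 0)"
    by (auto intro!: derivative_eq_intros)
  moreover have "((\<lambda>r. y + r * b + s * h t) has_real_derivative b) (at 0)"
    by (auto intro!: derivative_eq_intros)
  moreover have "((\<lambda>r. u + r * c - s * (deriv g t + (y + r * b) * (deriv ^^ 2) h t / 2)
        - s\<^sup>2 * (h t * (deriv ^^ 2) h t / 4))
      has_real_derivative c - s * b * (deriv ^^ 2) h t / 2) (at 0)"
    by (auto intro!: derivative_eq_intros)
  ultimately show "((\<lambda>r. shear g h s ((t, x, y, u) + r *\<^sub>R (0, a, b, c))) has_vector_derivative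
      (0, a + s * b * deriv h t / 2, b, c - s * b * (deriv ^^ 2) h t / 2)) (at 0)"
    by (simp add: shear_def has_vector_derivative_Pair has_real_derivative_iff_has_vector_derivative)
qed

lemma Ad_G_shear:
  assumes "open_interval J" "open_interval K" "J \<subseteq> K" "smooth_on K g" "smooth_on K h"
    and "\<And>t x y u. t \<in> J \<Longrightarrow>
      frechet_derivative (shear g h s) (at (t, x, y, u)) (w (t, x, y, u)) = w' (shear g h s (t, x, y, u))"
  shows "\<exists>B A. Ad_G J B J A \<and> A (restr J w) = restr J w'"
proof (rule Ad_G_step[OF Ad_G.Id[OF assms(1)] _ assms(2) _ shear_local_flow[OF assms(2,4,5,3)]
      assms(1) shear_image shear_inj])
  show "restr K (zk_field 0 g h (\<lambda>_. 0)) \<in> zk_algebra K"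
    unfolding zk_algebra_eq using assms(4,5) smooth_on_const by blast
qed (use assms(6) in auto)

text \<open>Bracketing with v_0 multiplies x_g by -2 and y_h by -1, so the flow of x_(g/2) + y_h up
  to time 1 subtracts exactly x_g + y_h. That sum commutes with the generator of the flow, so there
  are no higher-order terms.\<close>

lemma normalizes_zk_field_V0:
  assumes "open_interval I" "smooth_on I g" "smooth_on I h"
  shows "normalizes I (zk_field 1 g h (\<lambda>_. 0)) V0"
proof -
  have "open I" using assms by (simp add: open_interval_def)
  then have g: "smooth_on I (\<lambda>t. g t / 2)" using smooth_on_cmult[of I g "1 / 2"] assms by simp
  have "\<exists>B A. Ad_G I B I A \<and> A (restr I (zk_field 1 g h (\<lambda>_. 0))) = restr I V0"
  proof (rule Ad_G_shear[OF assms(1,1) order_refl g assms(3)])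
    fix t x y u assume t: "t \<in> I"
    have "deriv (\<lambda>t. g t / 2) t = deriv g t / 2"
      using funpow_deriv_cmult[OF \<open>open I\<close> assms(2) t, of 1 "1 / 2"] by simp
    then show "frechet_derivative (shear (\<lambda>t. g t / 2) h 1) (at (t, x, y, u))
        (zk_field 1 g h (\<lambda>_. 0) (t, x, y, u)) = V0 (shear (\<lambda>t. g t / 2) h 1 (t, x, y, u))"
      unfolding zk_field_apply
      by (subst frechet_derivative_shear[OF g assms(3) t]) (simp add: shear_def V0_def field_simps)
  qed
  then show ?thesis unfolding normalizes_def using assms(1) by blast
qed

lemma normalizes_zk_field_X:
  assumes "open_interval I" "t0 \<in> I" "smooth_on I g" "g t0 > 0"
  shows "normalizes I (zk_field 0 g (\<lambda>_. 0) (\<lambda>_. 0)) (X (\<lambda>_. 1))"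
proof -
  have "open I" using assms by (simp add: open_interval_def)
  obtain r R G H where r: "r > 0" "{t0 - r<..<t0 + r} \<subseteq> I"
    and sm: "smooth_on UNIV R" "smooth_on UNIV G" "smooth_on UNIV H" "\<And>t. R t > 0"
    and eq: "\<And>t. t \<in> {t0 - r<..<t0 + r} \<Longrightarrow> R t = g t" "\<And>t. t \<in> {t0 - r<..<t0 + r} \<Longrightarrow> G t = g t"
      "\<And>t. t \<in> {t0 - r<..<t0 + r} \<Longrightarrow> H t = g t"
    and "\<And>t. t \<notin> {t0 - 2 * r<..<t0 + 2 * r} \<Longrightarrow> R t = 1 \<and> G t = 0 \<and> H t = 0"
    by (rule extend_positive[OF \<open>open I\<close> assms(2,3,3,3,4)]) (rule that)
  then have out: "\<And>t. t \<notin> {t0 - 2 * r<..<t0 + 2 * r} \<Longrightarrow> R t = 1" by blast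
  let ?J = "{t0 - r<..<t0 + r}"
  have J: "open_interval ?J" using r by (simp add: open_interval_Ioo)
  have "\<exists>J' B A. open_interval J' \<and> Ad_G ?J B J' A \<and>
      A (restr ?J (zk_field 0 g (\<lambda>_. 0) (\<lambda>_. 0))) = restr J' (X (\<lambda>_. 1))"
  proof (rule pure_zk_chart_transport[OF sm(1,4) out Ad_G.Id[OF J]])
    show "zk_field 0 g (\<lambda>_. 0) (\<lambda>_. 0) p = zk_field 0 R (\<lambda>_. 0) (\<lambda>_. 0) p"
      if "fst p \<in> ?J" for p
      by (rule zk_field_cong[OF _ that]) (simp_all add: eq)
    show "X (\<lambda>_. 1) p = zk_field 0 R (\<lambda>_. 0) (\<lambda>_. 0) p" if "fst p > t0 + 2 * r" for p
      unfolding X_eq by (rule zk_field_cong[of "{t0 + 2 * r<..}"]) (use that out in auto)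
  qed (use r in simp_all)
  then show ?thesis unfolding normalizes_def using J r(2) by blast
qed

lemma normalizes_zk_field_Y:
  assumes "open_interval I" "t0 \<in> I" "smooth_on I g" "smooth_on I h" "h t0 > 0"
  shows "normalizes I (zk_field 0 g h (\<lambda>_. 0)) (Y (\<lambda>_. 1))"
proof -
  have "open I" using assms by (simp add: open_interval_def)
  \<comment> \<open>Restricting to h > 0 makes the square root of h smooth. The root is what gets
    extended, so that the global coefficient of y is a square, as the transport along z_F
    demands.\<close>
  define I' where "I' = I \<inter> h -` {0<..}"
  have I': "open I'" "t0 \<in> I'" "I' \<subseteq> I" "\<And>t. t \<in> I' \<Longrightarrow> h t > 0"
    using assms \<open>open I\<close> smooth_on_imp_continuous_on
    by (auto simp: I'_def intro!: continuous_open_preimage)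
  have sm': "smooth_on I' (\<lambda>t. h t powr (1 / 2))" "smooth_on I' g"
    using assms I' by (auto intro!: smooth_on_powr_compose intro: smooth_on_subset)
  have pos: "h t0 powr (1 / 2) > 0" using assms by simp
  obtain r R G H where r: "r > 0" "{t0 - r<..<t0 + r} \<subseteq> I'"
    and sm: "smooth_on UNIV R" "smooth_on UNIV G" "smooth_on UNIV H" "\<And>t. R t > 0"
    and eq: "\<And>t. t \<in> {t0 - r<..<t0 + r} \<Longrightarrow> R t = h t powr (1 / 2)"
      "\<And>t. t \<in> {t0 - r<..<t0 + r} \<Longrightarrow> G t = g t" "\<And>t. t \<in> {t0 - r<..<t0 + r} \<Longrightarrow> H t = g t"
    and "\<And>t. t \<notin> {t0 - 2 * r<..<t0 + 2 * r} \<Longrightarrow> R t = 1 \<and> G t = 0 \<and> H t = 0"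
    by (rule extend_positive[OF I'(1,2) sm'(1,2,2) pos]) (rule that)
  then have out: "\<And>t. t \<notin> {t0 - 2 * r<..<t0 + 2 * r} \<Longrightarrow> R t = 1" by blast
  let ?J = "{t0 - r<..<t0 + r}"
  have J: "open_interval ?J" using r by (simp add: open_interval_Ioo)
  define K where "K = (\<lambda>t. (R t)\<^sup>2)"
  have K: "smooth_on UNIV K" unfolding K_def power2_eq_square using sm by (intro smooth_on_mult) auto
  have Kpos: "K t > 0" for t using sm(4)[of t] by (simp add: K_def)
  have eqK: "K t = h t" if "t \<in> ?J" for t
    using eq(1)[OF that] I'(4)[of t] that r(2) by (auto simp: K_def powr_half_sqrt)
  \<comment> \<open>Dividing K P' - K' P = -2 G by K^2 gives (P/K)' = -2 G/K^2, so an antiderivative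
    \<open>Q\<close> of G/K^2 solves the equation with P = -2 K Q.\<close>
  have smQ: "smooth_on UNIV (\<lambda>t. G t / (K t * K t))"
    using sm K Kpos by (intro smooth_on_divide smooth_on_mult) auto
  obtain Q where Q: "\<And>t. (Q has_real_derivative G t / (K t * K t)) (at t)"
    using antiderivative_exists[OF smooth_on_imp_continuous_on[OF smQ]] by blast
  have "smooth_on UNIV Q" by (rule smooth_on_antiderivative[OF _ smQ Q]) simp
  \<comment> \<open>\<open>P\<close> solves \<open>K P' - K' P = - 2 G\<close>, so that \<open>[y\<^sub>K, y\<^sub>P] = - x\<^sub>G\<close>: the flow of \<open>y\<^sub>P\<close> removes \<open>x\<^sub>G\<close>.\<close>
  define P where "P = (\<lambda>t. - 2 * (K t * Q t))"
  have P: "smooth_on UNIV P"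
    unfolding P_def by (intro smooth_on_cmult smooth_on_mult K \<open>smooth_on UNIV Q\<close> open_UNIV)
  note DK = smooth_on_DERIV[OF K UNIV_I] and DP = smooth_on_DERIV[OF P UNIV_I]
    and DK2 = smooth_on_DERIV_2[OF K UNIV_I] and DP2 = smooth_on_DERIV_2[OF P UNIV_I]
  have PQ: "P t = - 2 * (K t * Q t)" for t by (simp add: P_def)
  have dP: "deriv P t = - 2 * (deriv K t * Q t + G t / K t)" for t
    unfolding P_def using Kpos[of t]
    by (intro DERIV_imp_deriv DERIV_cong[OF DERIV_cmult[OF DERIV_mult[OF DK Q]]]) simp
  have PK: "G t = P t * deriv K t / 2 - K t * deriv P t / 2" for t
    using Kpos[of t] by (simp add: PQ[of t] dP[of t] field_simps)
  then have "G = (\<lambda>t. P t * deriv K t / 2 - K t * deriv P t / 2)" by blast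
  then have "(G has_real_derivative P t * (deriv ^^ 2) K t / 2 - K t * (deriv ^^ 2) P t / 2) (at t)"
    for t
    by (rule ssubst) (rule DERIV_cong[OF DERIV_diff[OF DERIV_cdivide[OF DERIV_mult[OF DP DK2]]
          DERIV_cdivide[OF DERIV_mult[OF DK DP2]]]], simp add: field_simps)
  then have PK': "deriv G t = P t * (deriv ^^ 2) K t / 2 - K t * (deriv ^^ 2) P t / 2" for t
    by (rule DERIV_imp_deriv)
  have "\<exists>B A. Ad_G ?J B ?J A \<and> A (restr ?J (zk_field 0 G K (\<lambda>_. 0))) =
      restr ?J (zk_field 0 (\<lambda>_. 0) K (\<lambda>_. 0))"
  proof (rule Ad_G_shear[OF J _ _ smooth_on_const[of _ 0] P])
    show "open_interval UNIV" by (simp add: open_interval_def)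
    fix t x y u
    show "frechet_derivative (shear (\<lambda>_. 0) P 1) (at (t, x, y, u))
        (zk_field 0 G K (\<lambda>_. 0) (t, x, y, u)) =
        zk_field 0 (\<lambda>_. 0) K (\<lambda>_. 0) (shear (\<lambda>_. 0) P 1 (t, x, y, u))"
      unfolding zk_field_apply
      by (subst frechet_derivative_shear[OF smooth_on_const P UNIV_I])
         (simp add: shear_def zk_field_apply PK PK' field_simps)
  qed simp
  moreover have "restr ?J (zk_field 0 G K (\<lambda>_. 0)) = restr ?J (zk_field 0 g h (\<lambda>_. 0))"
    by (intro restr_cong zk_field_cong[of ?J]) (auto simp: eq eqK)
  ultimately obtain B A where AB: "Ad_G ?J B ?J A"
    "A (restr ?J (zk_field 0 g h (\<lambda>_. 0))) = restr ?J (zk_field 0 (\<lambda>_. 0) K (\<lambda>_. 0))"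
    by auto
  have "\<exists>J' B A. open_interval J' \<and> Ad_G ?J B J' A \<and>
      A (restr ?J (zk_field 0 g h (\<lambda>_. 0))) = restr J' (Y (\<lambda>_. 1))"
  proof (rule pure_zk_chart_transport[where A = A and v = "restr ?J (zk_field 0 g h (\<lambda>_. 0))"
        and w = "zk_field 0 (\<lambda>_. 0) K (\<lambda>_. 0)" and V = "zk_field 0 (\<lambda>_. 0) K (\<lambda>_. 0)"
        and w' = "Y (\<lambda>_. 1)", OF sm(1,4) out AB])
    show "Y (\<lambda>_. 1) p = zk_field 0 (\<lambda>_. 0) K (\<lambda>_. 0) p" if "fst p > t0 + 2 * r" for p
      unfolding Y_eq by (rule zk_field_cong[of "{t0 + 2 * r<..}"]) (use that out in \<open>auto simp: K_def\<close>)
  qed (use r K_def in simp_all)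
  then show ?thesis unfolding normalizes_def using J r(2) I'(3) by blast
qed


section \<open>From generators to one-dimensional subalgebras\<close>

lemma vf_span_scale: "c \<noteq> 0 \<Longrightarrow> vf_span {\<lambda>p. c *\<^sub>R v p} = vf_span {v}"
  unfolding vf_span_singleton
  by (auto simp: image_iff fun_eq_iff) (metis nonzero_eq_divide_eq scaleR_scaleR)+

lemma restr_image_span:
  "J \<subseteq> I \<Longrightarrow> restr J ` vf_span {restr I u} = vf_span {restr J u}"
  by (auto simp: vf_span_singleton image_image restr_def fun_eq_iff intro!: image_cong)

text \<open>The factor \<open>c\<close> lets a generator be rescaled before it is normalised: it
  makes the leading coefficient positive at a chosen point, or the coefficient of v_0 equal to
  1.\<close>

lemma equivalent_if_normalizes:
  assumes "normalizes I u' w" "c \<noteq> 0" "\<And>p. fst p \<in> I \<Longrightarrow> u' p = c *\<^sub>R u p"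
  shows "\<exists>J J'. open_interval J \<and> J \<subseteq> I \<and> open_interval J' \<and>
    equivalent J (restr J ` vf_span {restr I u}) J' (vf_span {restr J' w})"
proof -
  obtain J J' B A where J: "open_interval J" "J \<subseteq> I" "open_interval J'"
    and A: "Ad_G J B J' A" "A (restr J u') = restr J' w"
    using assms(1) unfolding normalizes_def by blast
  have "restr J u' = (\<lambda>p. c *\<^sub>R restr J u p)" using assms(3) J(2)
    by (intro ext) (simp add: restr_def subset_iff)
  then have "vf_span {restr J u'} = vf_span {restr J u}" by (simp add: vf_span_scale assms(2))
  then have "vf_span {restr J' w} = A ` (restr J ` vf_span {restr I u})"
    using Ad_G_span[OF A(1), of "restr J u'"] by (simp add: A(2) restr_image_span[OF J(2)])
  then show ?thesis using J A(1) unfolding equivalent_def by blast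
qed

lemma subspace_dim_1:
  assumes "vf_subspace S" "vf_dim S = 1"
  obtains v where "v \<noteq> 0" "S = vf_span {v}"
proof -
  obtain B where B: "B \<subseteq> S" "\<not> vf.dependent B" "S \<subseteq> vf_span B" "card B = 1"
    using vf.basis_exists[of S] assms(2) by metis
  then obtain v where v: "B = {v}" by (meson card_1_singletonE)
  have "v \<noteq> 0" using B(2) v vf.dependent_zero by blast
  moreover have "S = vf_span {v}"
    using B v assms(1) vf.span_minimal by blast
  ultimately show ?thesis by (rule that)
qed

lemma L_eqs:
  "L11 J = vf_span {restr J (X (\<lambda>_. 1))}" "L12 J = vf_span {restr J (Y (\<lambda>_. 1))}"
  "L13 J = vf_span {restr J V0}"
  "L14 k0 J = vf_span {restr J (zk_field k0 (\<lambda>_. 0) (\<lambda>_. 0) (\<lambda>_. 1))}"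
  by (simp_all add: L11_def L12_def L13_def L14_def V0_Z1_eq)

text \<open>The type is decided by the first nonzero item in the order f, k0, h, g, since each
  normalisation absorbs everything later in the list. In the case of f the sign passes to k0, which
  stays within the family of the fourth type.\<close>

lemma zk_field_normalizable:
  assumes I: "open_interval I" and sm: "smooth_on I g" "smooth_on I h" "smooth_on I f"
    and "restr I (zk_field k0 g h f) \<noteq> 0"
  shows "\<exists>c u' w i. c \<noteq> 0 \<and> normalizes I u' w \<and> (\<forall>p. fst p \<in> I \<longrightarrow> u' p = c *\<^sub>R zk_field k0 g h f p) \<and>
    i < 4 \<and> (\<forall>J. vf_span {restr J w} \<in> L1_types J ! i)"
proof -
  have "open I" using I by (simp add: open_interval_def)
  have sgn: "sgn a * a > 0" if "a \<noteq> 0" for a :: real using that by (simp add: sgn_if)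
  note scale = zk_field_scale[OF \<open>open I\<close> _ sm]
  note smc = smooth_on_cmult[OF \<open>open I\<close>]
  consider (Z) t0 where "t0 \<in> I" "f t0 \<noteq> 0"
    | (V0) "\<forall>t\<in>I. f t = 0" "k0 \<noteq> 0"
    | (Y) t0 where "\<forall>t\<in>I. f t = 0" "k0 = 0" "t0 \<in> I" "h t0 \<noteq> 0"
    | (X) t0 where "\<forall>t\<in>I. f t = 0" "k0 = 0" "\<forall>t\<in>I. h t = 0" "t0 \<in> I" "g t0 \<noteq> 0"
    | (zero) "\<forall>t\<in>I. f t = 0" "k0 = 0" "\<forall>t\<in>I. h t = 0" "\<forall>t\<in>I. g t = 0" by blast
  then show ?thesis
  proof cases
    case Z
    let ?c = "sgn (f t0)"
    have "normalizes I (zk_field (?c * k0) (\<lambda>t. ?c * g t) (\<lambda>t. ?c * h t) (\<lambda>t. ?c * f t))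
        (zk_field (?c * k0) (\<lambda>_. 0) (\<lambda>_. 0) (\<lambda>_. 1))"
      using normalizes_zk_field_Z[OF I Z(1) smc[OF sm(1)] smc[OF sm(2)] smc[OF sm(3)]] sgn Z by blast
    moreover have "vf_span {restr J (zk_field (?c * k0) (\<lambda>_. 0) (\<lambda>_. 0) (\<lambda>_. 1))} \<in> L1_types J ! 3" for J
      by (auto simp: L1_types_def L_eqs numeral_3_eq_3)
    ultimately show ?thesis using scale Z
      by (intro exI[of _ ?c] exI[of _ "zk_field (?c * k0) (\<lambda>_. 0) (\<lambda>_. 0) (\<lambda>_. 1)"] exI[of _ 3]
          exI[of _ "zk_field (?c * k0) (\<lambda>t. ?c * g t) (\<lambda>t. ?c * h t) (\<lambda>t. ?c * f t)"])
         (auto simp: sgn_eq_0_iff)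
  next
    case V0
    let ?c = "1 / k0"
    have "normalizes I (zk_field 1 (\<lambda>t. ?c * g t) (\<lambda>t. ?c * h t) (\<lambda>_. 0)) V0"
      by (rule normalizes_zk_field_V0[OF I smc[OF sm(1)] smc[OF sm(2)]])
    moreover have "zk_field 1 (\<lambda>t. ?c * g t) (\<lambda>t. ?c * h t) (\<lambda>_. 0) p = ?c *\<^sub>R zk_field k0 g h f p"
      if "fst p \<in> I" for p
      unfolding scale[OF that, symmetric] using V0
      by (simp, intro zk_field_cong[OF \<open>open I\<close> that]) auto
    moreover have "vf_span {restr J V0} \<in> L1_types J ! 2" for J
      by (auto simp: L1_types_def L_eqs numeral_2_eq_2)
    ultimately show ?thesis using V0
      by (intro exI[of _ ?c] exI[of _ "V0"] exI[of _ 2]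
          exI[of _ "zk_field 1 (\<lambda>t. ?c * g t) (\<lambda>t. ?c * h t) (\<lambda>_. 0)"]) auto
  next
    case Y
    let ?c = "sgn (h t0)"
    have "normalizes I (zk_field 0 (\<lambda>t. ?c * g t) (\<lambda>t. ?c * h t) (\<lambda>_. 0)) (Y (\<lambda>_. 1))"
      using normalizes_zk_field_Y[OF I Y(3) smc[OF sm(1)] smc[OF sm(2)]] sgn Y by blast
    moreover have "zk_field 0 (\<lambda>t. ?c * g t) (\<lambda>t. ?c * h t) (\<lambda>_. 0) p = ?c *\<^sub>R zk_field k0 g h f p"
      if "fst p \<in> I" for p
      unfolding scale[OF that, symmetric] using Y
      by (simp, intro zk_field_cong[OF \<open>open I\<close> that]) auto
    moreover have "vf_span {restr J (Y (\<lambda>_. 1))} \<in> L1_types J ! 1" for J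
      by (auto simp: L1_types_def L_eqs)
    ultimately show ?thesis using Y
      by (intro exI[of _ ?c] exI[of _ "Y (\<lambda>_. 1)"] exI[of _ 1]
          exI[of _ "zk_field 0 (\<lambda>t. ?c * g t) (\<lambda>t. ?c * h t) (\<lambda>_. 0)"]) (auto simp: sgn_eq_0_iff)
  next
    case X
    let ?c = "sgn (g t0)"
    have "normalizes I (zk_field 0 (\<lambda>t. ?c * g t) (\<lambda>_. 0) (\<lambda>_. 0)) (X (\<lambda>_. 1))"
      using normalizes_zk_field_X[OF I X(4) smc[OF sm(1)]] sgn X by blast
    moreover have "zk_field 0 (\<lambda>t. ?c * g t) (\<lambda>_. 0) (\<lambda>_. 0) p = ?c *\<^sub>R zk_field k0 g h f p"
      if "fst p \<in> I" for p
      unfolding scale[OF that, symmetric] using X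
      by (simp, intro zk_field_cong[OF \<open>open I\<close> that]) auto
    moreover have "vf_span {restr J (X (\<lambda>_. 1))} \<in> L1_types J ! 0" for J
      by (auto simp: L1_types_def L_eqs)
    ultimately show ?thesis using X
      by (intro exI[of _ ?c] exI[of _ "X (\<lambda>_. 1)"] exI[of _ 0]
          exI[of _ "zk_field 0 (\<lambda>t. ?c * g t) (\<lambda>_. 0) (\<lambda>_. 0)"]) (auto simp: sgn_eq_0_iff)
  next
    case zero
    have "zk_field k0 g h f p = 0" if "fst p \<in> I" for p
    proof -
      have "zk_field k0 g h f p = zk_field 0 (\<lambda>_. 0) (\<lambda>_. 0) (\<lambda>_. 0) p"
        unfolding zero(2) by (rule zk_field_cong[OF \<open>open I\<close> that]) (use zero in auto)
      also have "\<dots> = 0"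
        by (cases p rule: prod_cases4) (simp add: zk_field_apply flip: zero_prod_def)
      finally show ?thesis .
    qed
    then have "restr I (zk_field k0 g h f) = 0" by (auto simp: restr_def fun_eq_iff)
    then show ?thesis using assms(5) by blast
  qed
qed

lemma one_dimensional_subalgebra_equivalent:
  assumes "open_interval I" "lie_subalgebra I S" "vf_dim S = 1"
  shows "\<exists>J J'. open_interval J \<and> J \<subseteq> I \<and> open_interval J' \<and>
    (\<exists>i<4. \<exists>S'\<in>L1_types J' ! i. equivalent J (restr J ` S) J' S')"
proof -
  obtain v where v: "v \<noteq> 0" "S = vf_span {v}"
    using subspace_dim_1 assms(2,3) unfolding lie_subalgebra_def by metis
  have "v \<in> vf_span {v}" by (rule vf.span_base) simp
  then have "v \<in> zk_algebra I" using assms(2) v unfolding lie_subalgebra_def by blast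
  then obtain k0 g h f where z: "v = restr I (zk_field k0 g h f)"
    and sm: "smooth_on I g" "smooth_on I h" "smooth_on I f" unfolding zk_algebra_eq by blast
  obtain c u' w i where c: "c \<noteq> 0" "normalizes I u' w"
    "\<And>p. fst p \<in> I \<Longrightarrow> u' p = c *\<^sub>R zk_field k0 g h f p"
    and i: "i < 4" "\<And>J. vf_span {restr J w} \<in> L1_types J ! i"
    using zk_field_normalizable[OF assms(1) sm] v z by blast
  show ?thesis using equivalent_if_normalizes[OF c(2,1,3)] i unfolding v z by blast
qed


section \<open>Structure of the flows and non-equivalence\<close>

text \<open>\<delta>^2 exp(-2 L x) is nonincreasing and \<delta>^2 exp(2 L x) nondecreasing, so a
  zero spreads to the right and to the left. Both directions matter: uniqueness is used from the
  start of a flow and from its end.\<close>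

lemma gronwall_zero:
  fixes \<delta> :: "real \<Rightarrow> real"
  assumes D: "\<And>s. s \<in> {a..b} \<Longrightarrow> (\<delta> has_real_derivative \<delta>' s) (at s within {a..b})"
    and bound: "\<And>s. s \<in> {a..b} \<Longrightarrow> \<bar>\<delta>' s\<bar> \<le> L * \<bar>\<delta> s\<bar>"
    and "r \<in> {a..b}" "\<delta> r = 0" "s \<in> {a..b}"
  shows "\<delta> s = 0"
proof -
  have cont: "continuous_on {a..b} \<delta>" using D DERIV_continuous_on by blast
  have D': "(\<delta> has_real_derivative \<delta>' x) (at x)" if "a < x" "x < b" for x
    using D[of x] that by (simp add: at_within_Icc_at)
  have le: "\<bar>\<delta> x * \<delta>' x\<bar> \<le> L * (\<delta> x)\<^sup>2" if "x \<in> {a..b}" for x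
    using mult_left_mono[OF bound[OF that], of "\<bar>\<delta> x\<bar>"]
    by (simp add: abs_mult power2_eq_square mult_ac)
  have DE: "((\<lambda>x. (\<delta> x)\<^sup>2 * exp (2 * k * x)) has_real_derivative
      2 * (\<delta> x * \<delta>' x + k * (\<delta> x)\<^sup>2) * exp (2 * k * x)) (at x)" if "a < x" "x < b" for x k
    by (rule derivative_eq_intros D'[OF that] refl)+ (simp add: algebra_simps power2_eq_square)
  have ce: "continuous_on {c..d} (\<lambda>x. (\<delta> x)\<^sup>2 * exp (2 * k * x))" if "{c..d} \<subseteq> {a..b}" for c d k
    using continuous_on_subset[OF cont that] by (intro continuous_intros)
  show ?thesis
  proof (cases "r \<le> s")
    case True
    have "(\<delta> s)\<^sup>2 * exp (2 * (- L) * s) \<le> (\<delta> r)\<^sup>2 * exp (2 * (- L) * r)"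
    proof (rule DERIV_nonpos_imp_decreasing_open[where f = "\<lambda>x. (\<delta> x)\<^sup>2 * exp (2 * (- L) * x)", OF True])
      fix x assume x: "r < x" "x < s"
      then have ab: "a < x" "x < b" using assms(3,5) by auto
      have "2 * (\<delta> x * \<delta>' x + - L * (\<delta> x)\<^sup>2) * exp (2 * (- L) * x) \<le> 0"
        using le[of x] ab abs_ge_self[of "\<delta> x * \<delta>' x"] by (intro mult_nonpos_nonneg[OF _ exp_ge_zero]) simp
      then show "\<exists>y. ((\<lambda>x. (\<delta> x)\<^sup>2 * exp (2 * (- L) * x)) has_real_derivative y) (at x) \<and> y \<le> 0"
        using DE[OF ab] by blast
    qed (use assms(3,5) in \<open>intro ce, auto\<close>)
    then show ?thesis using assms(4) by (simp add: mult_le_0_iff)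
  next
    case False
    have "(\<delta> s)\<^sup>2 * exp (2 * L * s) \<le> (\<delta> r)\<^sup>2 * exp (2 * L * r)"
    proof (rule DERIV_nonneg_imp_increasing_open[where f = "\<lambda>x. (\<delta> x)\<^sup>2 * exp (2 * L * x)"])
      fix x assume x: "s < x" "x < r"
      then have ab: "a < x" "x < b" using assms(3,5) by auto
      have "2 * (\<delta> x * \<delta>' x + L * (\<delta> x)\<^sup>2) * exp (2 * L * x) \<ge> 0"
        using le[of x] ab abs_ge_minus_self[of "\<delta> x * \<delta>' x"] by (intro mult_nonneg_nonneg[OF _ exp_ge_zero]) simp
      then show "\<exists>y. ((\<lambda>x. (\<delta> x)\<^sup>2 * exp (2 * L * x)) has_real_derivative y) (at x) \<and> y \<ge> 0"
        using DE[OF ab] by blast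
    qed (use False assms(3,5) in \<open>simp, intro ce, auto\<close>)
    then show ?thesis using assms(4) by (simp add: mult_le_0_iff)
  qed
qed

text \<open>The order of quantifiers is the point: one factor \<open>E\<close> serves all solutions,
  so differences of trajectories depend linearly on initial differences.\<close>

lemma linear_ode_propagator:
  fixes m :: "real \<Rightarrow> real"
  assumes "continuous_on {a..b} m" "c \<in> {a..b}"
  shows "\<exists>E. (\<forall>s\<in>{a..b}. E s \<noteq> 0) \<and>
    (\<forall>\<delta>. (\<forall>s\<in>{a..b}. (\<delta> has_real_derivative m s * \<delta> s) (at s within {a..b})) \<longrightarrow>
      (\<forall>s\<in>{a..b}. \<delta> s = E s * \<delta> c))"
proof -
  obtain M where M: "\<And>s. s \<in> {a..b} \<Longrightarrow> (M has_real_derivative m s) (at s within {a..b})"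
    using antiderivative_continuous[OF assms(1)]
    by (auto simp: has_real_derivative_iff_has_vector_derivative)
  show ?thesis
  proof (intro exI[of _ "\<lambda>s. exp (M s - M c)"] conjI allI impI ballI)
    fix \<delta> s
    assume \<delta>: "\<forall>s\<in>{a..b}. (\<delta> has_real_derivative m s * \<delta> s) (at s within {a..b})"
      and s: "s \<in> {a..b}"
    have "((\<lambda>s. \<delta> s * exp (- M s)) has_real_derivative 0) (at s within {a..b})" if "s \<in> {a..b}" for s
      by (rule derivative_eq_intros \<delta>[rule_format, OF that] M[OF that] refl)+ (simp add: algebra_simps)
    then have "\<exists>k. \<forall>s\<in>{a..b}. \<delta> s * exp (- M s) = k"
      by (intro has_field_derivative_zero_constant) auto
    then have "\<delta> s * exp (- M s) = \<delta> c * exp (- M c)" using s assms(2) by metis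
    then show "\<delta> s = exp (M s - M c) * \<delta> c"
      by (simp add: exp_diff exp_minus field_simps)
  qed simp
qed

text \<open>The shape, on vectors without \<open>\<partial>\<^sub>t\<close>-component, of the derivative of a map in \<open>G\<close>.\<close>

definition triangular :: "(point \<Rightarrow> point) \<Rightarrow> bool" where
  "triangular D \<longleftrightarrow> linear D \<and> (\<exists>\<alpha> \<beta> \<gamma> m n k. \<alpha> \<noteq> 0 \<and> \<beta> \<noteq> 0 \<and> \<gamma> \<noteq> 0 \<and>
     (\<forall>a b c. D (0, a, b, c) = (0, \<alpha> * a + m * b, \<beta> * b, \<gamma> * c + n * a + k * b)))"

lemma triangular_comp:
  assumes "triangular D" "triangular D'" shows "triangular (D' \<circ> D)"
proof -
  obtain \<alpha> \<beta> \<gamma> m n k where D: "\<alpha> \<noteq> 0" "\<beta> \<noteq> 0" "\<gamma> \<noteq> 0"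
    "\<And>a b c. D (0, a, b, c) = (0, \<alpha> * a + m * b, \<beta> * b, \<gamma> * c + n * a + k * b)"
    using assms(1) unfolding triangular_def by blast
  obtain \<alpha>' \<beta>' \<gamma>' m' n' k' where D': "\<alpha>' \<noteq> 0" "\<beta>' \<noteq> 0" "\<gamma>' \<noteq> 0"
    "\<And>a b c. D' (0, a, b, c) = (0, \<alpha>' * a + m' * b, \<beta>' * b, \<gamma>' * c + n' * a + k' * b)"
    using assms(2) unfolding triangular_def by blast
  have "(D' \<circ> D) (0, a, b, c) = (0, (\<alpha>' * \<alpha>) * a + (\<alpha>' * m + m' * \<beta>) * b, (\<beta>' * \<beta>) * b,
      (\<gamma>' * \<gamma>) * c + (\<gamma>' * n + n' * \<alpha>) * a + (\<gamma>' * k + n' * m + k' * \<beta>) * b)" for a b c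
    by (simp add: D D' algebra_simps)
  moreover have "\<alpha>' * \<alpha> \<noteq> 0" "\<beta>' * \<beta> \<noteq> 0" "\<gamma>' * \<gamma> \<noteq> 0" using D D' by simp_all
  moreover have "linear (D' \<circ> D)" using assms by (auto simp: triangular_def intro: linear_compose)
  ultimately show ?thesis unfolding triangular_def by blast
qed

lemmas bounded_linear_coords = bounded_linear_fst[where ?'a = real and ?'b = "real \<times> real \<times> real"]
  bounded_linear_compose[OF bounded_linear_fst
    bounded_linear_snd[where ?'a = real and ?'b = "real \<times> real \<times> real"]]
  bounded_linear_compose[OF bounded_linear_fst bounded_linear_compose[OF bounded_linear_snd
    bounded_linear_snd[where ?'a = real and ?'b = "real \<times> real \<times> real"]]]
  bounded_linear_compose[OF bounded_linear_snd bounded_linear_compose[OF bounded_linear_snd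
    bounded_linear_snd[where ?'a = real and ?'b = "real \<times> real \<times> real"]]]

text \<open>An arbitrary generator of \<open>G\<close>, of which nothing is known beyond its
  differential equation. The endpoints \<open>lo\<close> and \<open>hi\<close> below cater for
  either sign of \<epsilon>.\<close>

locale zk_flow =
  fixes K J :: "real set" and k0 :: real and g h f :: "real \<Rightarrow> real" and \<epsilon> :: real
    and \<Phi> :: "real \<Rightarrow> point \<Rightarrow> point"
  assumes K: "open_interval K" and J: "open_interval J"
    and sm: "smooth_on K g" "smooth_on K h" "smooth_on K f"
    and flow: "local_flow K (restr K (zk_field k0 g h f)) J \<epsilon> \<Phi>"
begin

definition "lo = min 0 \<epsilon>"
definition "hi = max 0 \<epsilon>"

lemma seg: "closed_segment 0 \<epsilon> = {lo..hi}"
  by (auto simp: closed_segment_eq_real_ivl lo_def hi_def)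

lemma ends: "0 \<in> {lo..hi}" "\<epsilon> \<in> {lo..hi}"
  by (auto simp: lo_def hi_def)

abbreviation "T s p \<equiv> fst (\<Phi> s p)"
abbreviation "Xc s p \<equiv> fst (snd (\<Phi> s p))"
abbreviation "Yc s p \<equiv> fst (snd (snd (\<Phi> s p)))"
abbreviation "U s p \<equiv> snd (snd (snd (\<Phi> s p)))"

lemma start: "fst p \<in> J \<Longrightarrow> \<Phi> 0 p = p"
  using flow by (simp add: local_flow_def)

lemma T_in: "fst p \<in> J \<Longrightarrow> s \<in> {lo..hi} \<Longrightarrow> T s p \<in> K"
  using flow by (simp add: local_flow_def seg)

lemma flow_vector_derivative:
  assumes "fst p \<in> J" "s \<in> {lo..hi}"
  shows "((\<lambda>r. \<Phi> r p) has_vector_derivative zk_field k0 g h f (T s p, Xc s p, Yc s p, U s p))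
    (at s within {lo..hi})"
proof -
  have "((\<lambda>r. \<Phi> r p) has_vector_derivative restr K (zk_field k0 g h f) (\<Phi> s p)) (at s within {lo..hi})"
    using flow assms by (simp add: local_flow_def seg)
  then show ?thesis using T_in[OF assms] by (simp add: restr_def)
qed

lemma derivs:
  assumes "fst p \<in> J" "s \<in> {lo..hi}"
  shows "((\<lambda>s. T s p) has_real_derivative f (T s p)) (at s within {lo..hi})"
    and "((\<lambda>s. Xc s p) has_real_derivative
        2 * k0 * Xc s p + g (T s p) + Yc s p * deriv h (T s p) / 2 +
        (2 * Xc s p * deriv f (T s p) + (Yc s p)\<^sup>2 * (deriv ^^ 2) f (T s p)) / 6)
      (at s within {lo..hi})"
    and "((\<lambda>s. Yc s p) has_real_derivative
        k0 * Yc s p + h (T s p) + 2 * Yc s p * deriv f (T s p) / 3) (at s within {lo..hi})"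
    and "((\<lambda>s. U s p) has_real_derivative
        2 * k0 * U s p - deriv g (T s p) - Yc s p * (deriv ^^ 2) h (T s p) / 2
        - (4 * U s p * deriv f (T s p) + 2 * Xc s p * (deriv ^^ 2) f (T s p)
           + (Yc s p)\<^sup>2 * (deriv ^^ 3) f (T s p)) / 6) (at s within {lo..hi})"
  using flow_vector_derivative[OF assms, THEN bounded_linear.has_vector_derivative[OF bounded_linear_coords(1)]]
    flow_vector_derivative[OF assms, THEN bounded_linear.has_vector_derivative[OF bounded_linear_coords(2)]]
    flow_vector_derivative[OF assms, THEN bounded_linear.has_vector_derivative[OF bounded_linear_coords(3)]]
    flow_vector_derivative[OF assms, THEN bounded_linear.has_vector_derivative[OF bounded_linear_coords(4)]]
  unfolding zk_field_apply fst_conv snd_conv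
  by (simp_all only: has_real_derivative_iff_has_vector_derivative)

lemma T_continuous: "fst p \<in> J \<Longrightarrow> continuous_on {lo..hi} (\<lambda>s. T s p)"
  by (rule DERIV_continuous_on[OF derivs(1)])

text \<open>The t-equation t' = f(t) is autonomous. Both trajectories have a compact convex hull
  inside the interval \<open>K\<close>, where f' is bounded, so f is Lipschitz there and
  \<open>gronwall_zero\<close> applies. \<open>r = 0\<close> yields preservation of fibres,
  \<open>r = \<epsilon>\<close> injectivity.\<close>

lemma T_unique:
  assumes "fst p \<in> J" "fst p' \<in> J" "r \<in> {lo..hi}" "s \<in> {lo..hi}" "T r p = T r p'"
  shows "T s p = T s p'"
proof -
  let ?C = "convex hull ((\<lambda>s. T s p) ` {lo..hi} \<union> (\<lambda>s. T s p') ` {lo..hi})"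
  have "?C \<subseteq> K"
    using T_in[OF assms(1)] T_in[OF assms(2)] K
    by (intro hull_minimal) (auto simp: open_interval_def is_interval_convex simp del: split_paired_All)
  moreover have "compact ?C"
    using T_continuous assms(1,2)
    by (intro compact_convex_hull compact_Un compact_continuous_image) auto
  moreover have "continuous_on K (deriv f)"
    using sm(3) smooth_on_deriv smooth_on_imp_continuous_on by blast
  ultimately have "bounded (deriv f ` ?C)"
    by (meson compact_continuous_image compact_imp_bounded continuous_on_subset)
  then obtain L where L: "\<And>z. z \<in> ?C \<Longrightarrow> norm (deriv f z) \<le> L"
    unfolding bounded_iff by blast
  have "\<bar>f (T s p) - f (T s p')\<bar> \<le> L * \<bar>T s p - T s p'\<bar>" if "s \<in> {lo..hi}" for s
  proof -
    have "norm (f (T s p) - f (T s p')) \<le> L * norm (T s p - T s p')"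
    proof (rule field_differentiable_bound[of ?C f "deriv f"])
      show "(f has_real_derivative deriv f z) (at z within ?C)" if "z \<in> ?C" for z
        using that \<open>?C \<subseteq> K\<close> smooth_on_DERIV[OF sm(3)] has_field_derivative_at_within by blast
      show "T s p \<in> ?C" "T s p' \<in> ?C" using that by (auto intro!: hull_inc)
    qed (use L in auto)
    then show ?thesis by simp
  qed
  note bound = this
  have "T s p - T s p' = 0"
    by (rule gronwall_zero[of lo hi "\<lambda>s. T s p - T s p'" "\<lambda>s. f (T s p) - f (T s p')" L r s,
          OF DERIV_diff[OF derivs(1)[OF assms(1)] derivs(1)[OF assms(2)]] bound assms(3) _ assms(4)])
       (simp_all add: assms(5))
  then show ?thesis by simp
qed

text \<open>Trajectories starting in one fibre share t(s), so y-differences solve a homogeneous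
  linear equation. Once the y's agree the same holds for x, and once the x's agree as well, for u;
  the inhomogeneous and quadratic terms cancel in this order.\<close>

lemma vertical_affine:
  assumes "t \<in> J"
  shows "\<exists>\<alpha> \<beta> \<gamma>. \<alpha> \<noteq> 0 \<and> \<beta> \<noteq> 0 \<and> \<gamma> \<noteq> 0 \<and> (\<forall>x y u x' y' u'.
    T \<epsilon> (t, x, y, u) = T \<epsilon> (t, x', y', u') \<and>
    Yc \<epsilon> (t, x, y, u) - Yc \<epsilon> (t, x', y', u') = \<beta> * (y - y') \<and>
    (y = y' \<longrightarrow> Xc \<epsilon> (t, x, y, u) - Xc \<epsilon> (t, x', y', u') = \<alpha> * (x - x') \<and>
    (x = x' \<longrightarrow> U \<epsilon> (t, x, y, u) - U \<epsilon> (t, x', y', u') = \<gamma> * (u - u'))))"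
proof -
  define \<tau> where "\<tau> = (\<lambda>s. T s (t, 0, 0, 0))"
  have \<tau>: "T s (t, x, y, u) = \<tau> s" if "s \<in> {lo..hi}" for s x y u
    unfolding \<tau>_def by (rule T_unique[OF _ _ ends(1) that]) (use assms start in auto)
  have "continuous_on {lo..hi} (\<lambda>s. deriv f (\<tau> s))"
    unfolding \<tau>_def
    by (rule continuous_on_compose2[OF smooth_on_imp_continuous_on[OF smooth_on_deriv[OF sm(3)]]])
       (use assms T_continuous T_in in auto)
  then have "continuous_on {lo..hi} (\<lambda>s. j * k0 + a * deriv f (\<tau> s))" for j a
    by (intro continuous_intros)
  note ode = linear_ode_propagator[OF this ends(1)]
  obtain E1 where E1: "\<And>s. s \<in> {lo..hi} \<Longrightarrow> E1 s \<noteq> 0" "\<And>\<delta> s. (\<And>s. s \<in> {lo..hi} \<Longrightarrow>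
      (\<delta> has_real_derivative (1 * k0 + 2 / 3 * deriv f (\<tau> s)) * \<delta> s) (at s within {lo..hi})) \<Longrightarrow>
      s \<in> {lo..hi} \<Longrightarrow> \<delta> s = E1 s * \<delta> 0"
    using ode[of 1 "2 / 3"] by (elim exE conjE) blast
  obtain E2 where E2: "\<And>s. s \<in> {lo..hi} \<Longrightarrow> E2 s \<noteq> 0" "\<And>\<delta> s. (\<And>s. s \<in> {lo..hi} \<Longrightarrow>
      (\<delta> has_real_derivative (2 * k0 + 1 / 3 * deriv f (\<tau> s)) * \<delta> s) (at s within {lo..hi})) \<Longrightarrow>
      s \<in> {lo..hi} \<Longrightarrow> \<delta> s = E2 s * \<delta> 0"
    using ode[of 2 "1 / 3"] by (elim exE conjE) blast
  obtain E3 where E3: "\<And>s. s \<in> {lo..hi} \<Longrightarrow> E3 s \<noteq> 0" "\<And>\<delta> s. (\<And>s. s \<in> {lo..hi} \<Longrightarrow>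
      (\<delta> has_real_derivative (2 * k0 + - 2 / 3 * deriv f (\<tau> s)) * \<delta> s) (at s within {lo..hi})) \<Longrightarrow>
      s \<in> {lo..hi} \<Longrightarrow> \<delta> s = E3 s * \<delta> 0"
    using ode[of 2 "- 2 / 3"] by (elim exE conjE) blast
  show ?thesis
  proof (rule exI[of _ "E2 \<epsilon>"], rule exI[of _ "E1 \<epsilon>"], rule exI[of _ "E3 \<epsilon>"],
      intro conjI allI impI)
    show "E2 \<epsilon> \<noteq> 0" "E1 \<epsilon> \<noteq> 0" "E3 \<epsilon> \<noteq> 0" using E2 E1 E3 ends(2) by auto
    fix x y u x' y' u' :: real
    let ?p = "(t, x, y, u)" and ?p' = "(t, x', y', u')"
    have J: "fst ?p \<in> J" "fst ?p' \<in> J" using assms by auto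
    note DY = DERIV_diff[OF derivs(3)[OF J(1)] derivs(3)[OF J(2)]]
      and DX = DERIV_diff[OF derivs(2)[OF J(1)] derivs(2)[OF J(2)]]
      and DU = DERIV_diff[OF derivs(4)[OF J(1)] derivs(4)[OF J(2)]]
    have init: "\<Phi> 0 ?p = ?p" "\<Phi> 0 ?p' = ?p'" using start J by auto
    show "T \<epsilon> ?p = T \<epsilon> ?p'" using \<tau> ends(2) by simp
    have Y: "Yc s ?p - Yc s ?p' = E1 s * (y - y')" if "s \<in> {lo..hi}" for s
      using E1(2)[of "\<lambda>s. Yc s ?p - Yc s ?p'", OF DERIV_cong[OF DY] that]
      by (simp add: init \<tau> field_simps)
    then show "Yc \<epsilon> ?p - Yc \<epsilon> ?p' = E1 \<epsilon> * (y - y')" using ends(2) by blast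
    {
      assume "y = y'"
      then have Yeq: "Yc s ?p = Yc s ?p'" if "s \<in> {lo..hi}" for s using Y[OF that] by simp
      have X: "Xc s ?p - Xc s ?p' = E2 s * (x - x')" if "s \<in> {lo..hi}" for s
        using E2(2)[of "\<lambda>s. Xc s ?p - Xc s ?p'", OF DERIV_cong[OF DX] that]
        by (simp add: init \<tau> Yeq field_simps)
      then show "Xc \<epsilon> ?p - Xc \<epsilon> ?p' = E2 \<epsilon> * (x - x')" using ends(2) by blast
      assume "x = x'"
      then have Xeq: "Xc s ?p = Xc s ?p'" if "s \<in> {lo..hi}" for s using X[OF that] by simp
      have "U s ?p - U s ?p' = E3 s * (u - u')" if "s \<in> {lo..hi}" for s
        using E3(2)[of "\<lambda>s. U s ?p - U s ?p'", OF DERIV_cong[OF DU] that]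
        by (simp add: init \<tau> Xeq Yeq field_simps)
      then show "U \<epsilon> ?p - U \<epsilon> ?p' = E3 \<epsilon> * (u - u')" using ends(2) by blast
    }
  qed
qed

text \<open>The coordinates are recovered in the order t, y, x, u. Injectivity makes
  \<open>inv_into\<close> in \<open>pushforward\<close> a genuine inverse.\<close>

lemma flow_inj: "inj_on (\<Phi> \<epsilon>) (cyl J)"
proof (rule inj_onI)
  fix p p' assume p: "p \<in> cyl J" "p' \<in> cyl J" "\<Phi> \<epsilon> p = \<Phi> \<epsilon> p'"
  then have "T 0 p = T 0 p'" by (intro T_unique[OF _ _ ends(2,1)]) auto
  then have "fst p = fst p'" using p start by simp
  then obtain t x y u x' y' u' where eq: "p = (t, x, y, u)" "p' = (t, x', y', u')"
    by (metis prod_cases4 fst_conv)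
  then have "t \<in> J" using p by simp
  with vertical_affine obtain \<alpha> \<beta> \<gamma> where "\<alpha> \<noteq> 0" "\<beta> \<noteq> 0" "\<gamma> \<noteq> 0" and
    *: "\<And>x y u x' y' u'. Yc \<epsilon> (t, x, y, u) - Yc \<epsilon> (t, x', y', u') = \<beta> * (y - y')"
      "\<And>x y u x' u'. Xc \<epsilon> (t, x, y, u) - Xc \<epsilon> (t, x', y, u') = \<alpha> * (x - x')"
      "\<And>x y u u'. U \<epsilon> (t, x, y, u) - U \<epsilon> (t, x, y, u') = \<gamma> * (u - u')"
    by metis
  have "y = y'" using *(1)[of x y u x' y' u'] p(3) \<open>\<beta> \<noteq> 0\<close> by (simp add: eq)
  moreover have "x = x'" using *(2)[of x y u x' u'] p(3) \<open>\<alpha> \<noteq> 0\<close> calculation by (simp add: eq)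
  moreover have "u = u'" using *(3)[of x y u u'] p(3) \<open>\<gamma> \<noteq> 0\<close> calculation by (simp add: eq)
  ultimately show "p = p'" by (simp add: eq)
qed

lemma flow_triangular:
  assumes "fst p \<in> J" shows "triangular (frechet_derivative (\<Phi> \<epsilon>) (at p))"
proof -
  obtain t x y u where p: "p = (t, x, y, u)" by (metis prod_cases4)
  let ?D = "frechet_derivative (\<Phi> \<epsilon>) (at p)"
  have t: "t \<in> J" using assms p by simp
  have diff: "\<Phi> \<epsilon> differentiable (at p)"
    using local_flow_differentiable[OF flow _ assms] J by (simp add: open_interval_def)
  then have lin: "linear ?D" by (rule linear_frechet_derivative)
  have "((\<lambda>r. p + r *\<^sub>R d) has_vector_derivative d) (at 0)" for d
    by (auto intro!: derivative_eq_intros)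
  then have line: "((\<lambda>r. \<Phi> \<epsilon> (p + r *\<^sub>R d)) has_vector_derivative ?D d) (at 0)" for d
    by (rule has_vector_derivative_has_derivative_compose)
       (use diff in \<open>simp add: frechet_derivative_works\<close>)
  \<comment> \<open>Along the chosen lines the component is exactly affine in \<open>r\<close>, so
    its derivative is the slope itself.\<close>
  have proj: "\<pi> (?D d) = k"
    if "bounded_linear \<pi>" "\<And>r. \<pi> (\<Phi> \<epsilon> (p + r *\<^sub>R d)) = \<pi> (\<Phi> \<epsilon> p) + k * r" for \<pi> k d
  proof -
    have "((\<lambda>r. \<pi> (\<Phi> \<epsilon> (p + r *\<^sub>R d))) has_real_derivative \<pi> (?D d)) (at 0)"
      using bounded_linear.has_vector_derivative[OF that(1) line]
      by (simp add: has_real_derivative_iff_has_vector_derivative)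
    moreover have "((\<lambda>r. \<pi> (\<Phi> \<epsilon> (p + r *\<^sub>R d))) has_real_derivative k) (at 0)"
      unfolding that(2) by (auto intro!: derivative_eq_intros)
    ultimately show ?thesis by (rule DERIV_unique)
  qed
  obtain \<alpha> \<beta> \<gamma> where nz: "\<alpha> \<noteq> 0" "\<beta> \<noteq> 0" "\<gamma> \<noteq> 0" and
    *: "\<And>x y u x' y' u'. T \<epsilon> (t, x, y, u) = T \<epsilon> (t, x', y', u')"
      "\<And>x y u x' y' u'. Yc \<epsilon> (t, x, y, u) - Yc \<epsilon> (t, x', y', u') = \<beta> * (y - y')"
      "\<And>x y u x' u'. Xc \<epsilon> (t, x, y, u) - Xc \<epsilon> (t, x', y, u') = \<alpha> * (x - x')"
      "\<And>x y u u'. U \<epsilon> (t, x, y, u) - U \<epsilon> (t, x, y, u') = \<gamma> * (u - u')"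
    using vertical_affine[OF t] by metis
  have DT: "fst (?D (0, a, b, c)) = 0" for a b c
    by (rule proj[OF bounded_linear_coords(1)]) (use *(1) in \<open>simp add: p\<close>)
  have DY: "fst (snd (snd (?D (0, a, b, c)))) = \<beta> * b" for a b c
    by (rule proj[OF bounded_linear_coords(3)])
       (use *(2)[of "x + _ * a" "y + _ * b" "u + _ * c" x y u] in \<open>simp add: p algebra_simps\<close>)
  have DX: "fst (snd (?D (0, a, 0, c))) = \<alpha> * a" for a c
    by (rule proj[OF bounded_linear_coords(2)])
       (use *(3)[of "x + _ * a" y "u + _ * c" x u] in \<open>simp add: p algebra_simps\<close>)
  have DU: "snd (snd (snd (?D (0, 0, 0, c)))) = \<gamma> * c" for c
    by (rule proj[OF bounded_linear_coords(4)])
       (use *(4)[of x y "u + _ * c" u] in \<open>simp add: p algebra_simps\<close>)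
  define m where "m = fst (snd (?D (0, 0, 1, 0)))"
  define n where "n = snd (snd (snd (?D (0, 1, 0, 0))))"
  define k where "k = snd (snd (snd (?D (0, 0, 1, 0))))"
  have "?D (0, a, b, c) = (0, \<alpha> * a + m * b, \<beta> * b, \<gamma> * c + n * a + k * b)" for a b c
  proof -
    have e: "?D (0, 1, 0, 0) = (0, \<alpha>, 0, n)" "?D (0, 0, 1, 0) = (0, m, \<beta>, k)"
      "?D (0, 0, 0, 1) = (0, 0, 0, \<gamma>)"
      using DT DY DX DU[of 1] DX[of 1 0] DX[of 0 1] DY[of 1 0 0] DY[of 0 1 0] DY[of 0 0 1]
      by (simp_all add: prod_eq_iff m_def n_def k_def)
    have "?D (0, a, b, c) = ?D (a *\<^sub>R (0, 1, 0, 0) + b *\<^sub>R (0, 0, 1, 0) + c *\<^sub>R (0, 0, 0, 1))"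
      by simp
    also have "\<dots> = a *\<^sub>R ?D (0, 1, 0, 0) + b *\<^sub>R ?D (0, 0, 1, 0) + c *\<^sub>R ?D (0, 0, 0, 1)"
      by (simp only: linear_add[OF lin] linear_scale[OF lin])
    finally show ?thesis by (simp add: e)
  qed
  then show ?thesis unfolding triangular_def using lin nz by blast
qed

end


section \<open>Maps of \<open>G\<close> and the properties that separate the types\<close>

declare split_paired_All [simp del] split_paired_Ex [simp del]

lemma triangular_id: "triangular id"
  unfolding triangular_def
proof
  show "linear (id :: point \<Rightarrow> point)"
    unfolding id_def by (rule bounded_linear.linear[OF bounded_linear_ident])
qed (rule exI[of _ 1], rule exI[of _ 1], rule exI[of _ 1], (rule exI[of _ 0])+, simp)

text \<open>The action of \<open>A\<close> is stated at image points \<open>B p\<close>, as the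
  tangent map of \<open>B\<close>; in this form it composes by the chain rule, and inverses occur
  only inside a single step.\<close>

lemma Ad_G_structure:
  assumes "Ad_G J B J' A"
  shows "open_interval J \<and> open_interval J' \<and> B ` cyl J = cyl J' \<and>
    (\<forall>p p'. fst p \<in> J \<longrightarrow> fst p = fst p' \<longrightarrow> fst (B p) = fst (B p')) \<and>
    (\<forall>p. fst p \<in> J \<longrightarrow> B differentiable (at p) \<and> triangular (frechet_derivative B (at p)) \<and>
      (\<forall>v. A v (B p) = frechet_derivative B (at p) (v p)))"
  using assms
proof (induction rule: Ad_G.induct)
  case (Id J)
  then show ?case
    using triangular_id by (simp add: id_def)
next
  case (Flow J B J' A K V \<epsilon> \<Phi> J'')
  obtain k0 g h f where V: "V = restr K (zk_field k0 g h f)"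
    and "smooth_on K g" "smooth_on K h" "smooth_on K f"
    using Flow.hyps(3) unfolding zk_algebra_eq by blast
  then interpret zk_flow K J' k0 g h f \<epsilon> \<Phi>
    using Flow.hyps Flow.IH by unfold_locales auto
  have B: "B ` cyl J = cyl J'" "\<And>p p'. fst p \<in> J \<Longrightarrow> fst p = fst p' \<Longrightarrow> fst (B p) = fst (B p')"
    "\<And>p. fst p \<in> J \<Longrightarrow> B differentiable (at p)"
    "\<And>p. fst p \<in> J \<Longrightarrow> triangular (frechet_derivative B (at p))"
    "\<And>p v. fst p \<in> J \<Longrightarrow> A v (B p) = frechet_derivative B (at p) (v p)"
    using Flow.IH by blast+
  have BJ: "fst (B p) \<in> J'" if "fst p \<in> J" for p
    using B(1) that by (metis image_eqI mem_cyl)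
  have diff: "\<Phi> \<epsilon> differentiable (at q)" if "fst q \<in> J'" for q
    using local_flow_differentiable[OF flow _ that] J by (simp add: open_interval_def)
  have comp: "frechet_derivative (\<Phi> \<epsilon> \<circ> B) (at p) =
      frechet_derivative (\<Phi> \<epsilon>) (at (B p)) \<circ> frechet_derivative B (at p)" if "fst p \<in> J" for p
    by (rule frechet_derivative_compose[OF B(3)[OF that] diff[OF BJ[OF that]]])
  show ?case
  proof (intro conjI allI impI)
    show "open_interval J" "open_interval J''" using Flow.IH Flow.hyps by auto
    show "(\<Phi> \<epsilon> \<circ> B) ` cyl J = cyl J''" using B(1) Flow.hyps(6) by (metis image_comp)
    fix p p' :: point assume p: "fst p \<in> J"
    show "(\<Phi> \<epsilon> \<circ> B) differentiable (at p)"
      by (rule differentiable_chain_at[OF B(3)[OF p] diff[OF BJ[OF p]]])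
    show "triangular (frechet_derivative (\<Phi> \<epsilon> \<circ> B) (at p))"
      unfolding comp[OF p] by (rule triangular_comp[OF B(4)[OF p] flow_triangular[OF BJ[OF p]]])
    show "(pushforward J' J'' (\<Phi> \<epsilon>) \<circ> A) v ((\<Phi> \<epsilon> \<circ> B) p) =
        frechet_derivative (\<Phi> \<epsilon> \<circ> B) (at p) (v p)" for v
    proof -
      have "\<Phi> \<epsilon> (B p) \<in> cyl J''" using BJ[OF p] Flow.hyps(6) by (metis image_eqI mem_cyl)
      moreover have "inv_into (cyl J') (\<Phi> \<epsilon>) (\<Phi> \<epsilon> (B p)) = B p"
        using BJ[OF p] by (intro inv_into_f_f flow_inj) simp
      ultimately show ?thesis by (simp add: comp[OF p] pushforward_def restr_def B(5)[OF p])
    qed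
    assume "fst p = fst p'"
    then show "fst ((\<Phi> \<epsilon> \<circ> B) p) = fst ((\<Phi> \<epsilon> \<circ> B) p')"
      using T_unique[of "B p" "B p'" 0 \<epsilon>] BJ[of p] BJ[of p'] start[of "B p"] start[of "B p'"]
        B(2)[of p p'] p ends by simp
  qed
qed

text \<open>Equality of spans is reduced to one relation between generators, up to a factor
  \<open>c\<close> that could still be 0 at this stage.\<close>

lemma equivalent_spanD:
  assumes "equivalent J (vf_span {restr J w}) J' (vf_span {restr J' w'})"
  shows "\<exists>B D c. open_interval J \<and> open_interval J' \<and> B ` cyl J = cyl J' \<and>
    (\<forall>p p'. fst p \<in> J \<longrightarrow> fst p = fst p' \<longrightarrow> fst (B p) = fst (B p')) \<and>
    (\<forall>p. fst p \<in> J \<longrightarrow> (B has_derivative D p) (at p) \<and> triangular (D p) \<and>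
       w' (B p) = c *\<^sub>R D p (w p))"
proof -
  obtain B A where A: "Ad_G J B J' A" "vf_span {restr J' w'} = A ` vf_span {restr J w}"
    using assms unfolding equivalent_def by blast
  then have "restr J' w' \<in> vf_span {A (restr J w)}"
    using Ad_G_span[OF A(1)] vf.span_base by (metis singletonI)
  then obtain c where c: "restr J' w' = (\<lambda>p. c *\<^sub>R A (restr J w) p)"
    unfolding vf_span_singleton by blast
  note B = Ad_G_structure[OF A(1)]
  have "w' (B p) = c *\<^sub>R frechet_derivative B (at p) (w p)" if p: "fst p \<in> J" for p
  proof -
    have "fst (B p) \<in> J'" using B p by (metis image_eqI mem_cyl)
    then have "w' (B p) = restr J' w' (B p)" by (simp add: restr_def)
    also have "\<dots> = c *\<^sub>R frechet_derivative B (at p) (restr J w p)" using B p by (simp add: c)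
    finally show ?thesis using p by (simp add: restr_def)
  qed
  then show ?thesis using B frechet_derivative_works
    by (intro exI[of _ B] exI[of _ "\<lambda>p. frechet_derivative B (at p)"] exI[of _ c]) blast
qed

definition generator :: "nat \<Rightarrow> vfield \<Rightarrow> bool" where
  "generator i w \<longleftrightarrow> (\<exists>k. w =
     [X (\<lambda>_. 1), Y (\<lambda>_. 1), V0, zk_field k (\<lambda>_. 0) (\<lambda>_. 0) (\<lambda>_. 1)] ! i)"

lemma L1_types_generator:
  assumes "i < 4" "S \<in> L1_types J ! i"
  shows "\<exists>w. S = vf_span {restr J w} \<and> generator i w"
proof -
  have "i = 0 \<or> i = 1 \<or> i = 2 \<or> i = 3" using assms(1) by linarith
  then show ?thesis using assms(2)
    by (auto simp: L1_types_def L_eqs generator_def numeral_2_eq_2 numeral_3_eq_3) blast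
qed

lemma generators_not_equivalent:
  assumes "generator i w" "generator j w'" "i < 4" "j < 4" "i \<noteq> j"
  shows "\<not> equivalent J (vf_span {restr J w}) J' (vf_span {restr J' w'})"
proof
  assume "equivalent J (vf_span {restr J w}) J' (vf_span {restr J' w'})"
  then obtain B D c where J: "open_interval J" "open_interval J'" and B: "B ` cyl J = cyl J'"
    and fib: "\<And>p p'. fst p \<in> J \<Longrightarrow> fst p = fst p' \<Longrightarrow> fst (B p) = fst (B p')"
    and DB: "\<And>p. fst p \<in> J \<Longrightarrow> (B has_derivative D p) (at p)"
    and tri: "\<And>p. fst p \<in> J \<Longrightarrow> triangular (D p)"
    and w': "\<And>p. fst p \<in> J \<Longrightarrow> w' (B p) = c *\<^sub>R D p (w p)"
    using equivalent_spanD by metis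
  obtain t t' where t: "t \<in> J" "t' \<in> J'" using J by (auto simp: open_interval_def)
  have gen: "(k = 0 \<and> v = (\<lambda>_. (0, 1, 0, 0))) \<or> (k = 1 \<and> v = (\<lambda>_. (0, 0, 1, 0))) \<or>
      (k = 2 \<and> v = V0) \<or> (k = 3 \<and> (\<exists>k0. \<forall>t x y u. v (t, x, y, u) = (1, 2 * k0 * x, k0 * y, 2 * k0 * u)))"
    if "k < 4" "generator k v" for k v
  proof -
    have "k = 0 \<or> k = 1 \<or> k = 2 \<or> k = 3" using that(1) by linarith
    then show ?thesis using that(2)
      by (auto simp: generator_def numeral_2_eq_2 numeral_3_eq_3 X_eq Y_eq zk_field_apply fun_eq_iff)
  qed
  note gi = gen[OF assms(3,1)] and gj = gen[OF assms(4,2)]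
  have pre: "\<exists>p. fst p \<in> J \<and> B p = (t', x, y, u)" for x y u
  proof -
    have "(t', x, y, u) \<in> B ` cyl J" using t(2) by (simp add: B)
    then show ?thesis by (metis imageE mem_cyl)
  qed
  have c: "c \<noteq> 0"
  proof
    assume "c = 0"
    \<comment> \<open>No generator vanishes at (t', 1, 0, 0); the entry 1 is there for v_0, which is
      zero at (t', 0, 0, 0).\<close>
    obtain p where "fst p \<in> J" "B p = (t', 1, 0, 0)" using pre by blast
    then have "w' (t', 1, 0, 0) = 0" using w' \<open>c = 0\<close> by fastforce
    then show False using gj by (auto simp: V0_def zero_prod_def)
  qed
  have D: "\<exists>\<alpha> \<beta> \<gamma> m n k. \<alpha> \<noteq> 0 \<and> \<beta> \<noteq> 0 \<and> \<gamma> \<noteq> 0 \<and>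
     (\<forall>a b c. D p (0, a, b, c) = (0, \<alpha> * a + m * b, \<beta> * b, \<gamma> * c + n * a + k * b))" if "fst p \<in> J" for p
    using tri[OF that] unfolding triangular_def by blast
  from gi show False
  proof (elim disjE conjE exE)
    assume i: "i = 0" and w: "w = (\<lambda>_. (0, 1, 0, 0))"
    \<comment> \<open>Over this point v_0 vanishes while the image of \<partial>_x does not; the
      image also has zero t- and y-components, which excludes the other two types.\<close>
    obtain p where p: "fst p \<in> J" "B p = (t', 0, 0, 0)" using pre by blast
    with D[of p] w'[of p] c gj assms(5) show False by (auto simp: w i V0_def)
  next
    assume i: "i = 1" and w: "w = (\<lambda>_. (0, 0, 1, 0))"
    obtain p where p: "fst p \<in> J" "B p = (t', 0, 0, 0)" using pre by blast
    with D[of p] w'[of p] c gj assms(5) show False by (auto simp: w i V0_def)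
  next
    assume i: "i = 2" and w: "w = V0"
    \<comment> \<open>v_0 vanishes at (t, 0, 0, 0), so \<open>w'\<close> must vanish at the image
      point; the generators of the other three types have no zeros.\<close>
    obtain t' x' y' u' where q: "B (t, 0, 0, 0) = (t', x', y', u')" by (metis prod_cases4)
    with D[of "(t, 0, 0, 0)"] w'[of "(t, 0, 0, 0)"] t(1) gj assms(5) show False
      by (auto simp: w i V0_def)
  next
    fix k0
    assume i: "i = 3" and w: "\<forall>t x y u. w (t, x, y, u) = (1, 2 * k0 * x, k0 * y, 2 * k0 * u)"
    \<comment> \<open>If \<open>w\<close> became vertical, the induced map of the \<open>t\<close>-axis would have derivative \<open>0\<close>; it would be
      constant, yet it maps onto an interval.\<close>
    have vert: "fst (w' q) = 0" for q
      using gj assms(5) i by (cases q rule: prod_cases4) (auto simp: V0_def)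
    have "((\<lambda>s. fst (B (s, 0, 0, 0))) has_real_derivative 0) (at s within J)" if s: "s \<in> J" for s
    proof -
      let ?p = "(s, 0, 0, 0)"
      have "((\<lambda>s. (s, 0, 0, 0)) has_vector_derivative (1, 0, 0, 0 :: real)) (at s)"
        by (auto intro!: derivative_eq_intros simp: zero_prod_def)
      then have "((\<lambda>s. B (s, 0, 0, 0)) has_vector_derivative D ?p (1, 0, 0, 0)) (at s)"
        by (rule has_vector_derivative_has_derivative_compose) (use DB s in simp)
      then have "((\<lambda>s. fst (B (s, 0, 0, 0))) has_vector_derivative fst (D ?p (1, 0, 0, 0))) (at s)"
        by (rule bounded_linear.has_vector_derivative[OF bounded_linear_fst])
      moreover have "fst (D ?p (1, 0, 0, 0)) = 0"
        using vert[of "B ?p"] w'[of ?p] c s by (simp add: w)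
      ultimately show ?thesis
        by (simp add: has_real_derivative_iff_has_vector_derivative has_vector_derivative_at_within)
    qed
    moreover have "convex J" using J by (simp add: open_interval_def is_interval_convex)
    ultimately obtain k where k: "\<And>s. s \<in> J \<Longrightarrow> fst (B (s, 0, 0, 0)) = k"
      using has_field_derivative_zero_constant[of J "\<lambda>s. fst (B (s, 0, 0, 0))"] by blast
    have "J' \<subseteq> {k}"
    proof
      fix s assume "s \<in> J'"
      then have "(s, 0, 0, 0) \<in> B ` cyl J" by (simp add: B)
      then obtain p where p: "fst p \<in> J" "B p = (s, 0, 0, 0)" by auto
      then show "s \<in> {k}" using k[OF p(1)] fib[of p "(fst p, 0, 0, 0)"] by simp
    qed
    then have "J' = {k}" using t(2) by blast
    then show False using J(2) not_open_singleton[of k] by (simp add: open_interval_def)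
  qed
qed


theorem mainTheorem1:
  shows "(\<forall>I S. open_interval I \<and> lie_subalgebra I S \<and> vf_dim S = 1 \<longrightarrow>
            (\<exists>J J'. open_interval J \<and> J \<subseteq> I \<and> open_interval J' \<and>
               (\<exists>i<4. \<exists>S'\<in>L1_types J' ! i. equivalent J (restr J ` S) J' S')))
       \<and> (\<forall>J J'. open_interval J \<and> open_interval J' \<longrightarrow>
            (\<forall>i<4. \<forall>j<4. i \<noteq> j \<longrightarrow>
               (\<forall>S\<in>L1_types J ! i. \<forall>S'\<in>L1_types J' ! j. \<not> equivalent J S J' S')))"
proof (intro conjI allI impI ballI)
  fix I S assume "open_interval I \<and> lie_subalgebra I S \<and> vf_dim S = 1"
  then show "\<exists>J J'. open_interval J \<and> J \<subseteq> I \<and> open_interval J' \<and>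
      (\<exists>i<4. \<exists>S'\<in>L1_types J' ! i. equivalent J (restr J ` S) J' S')"
    using one_dimensional_subalgebra_equivalent by blast
next
  fix J J' i j S S'
  assume "i < 4" "j < 4" "i \<noteq> j" "S \<in> L1_types J ! i" "S' \<in> L1_types J' ! j"
  then show "\<not> equivalent J S J' S'"
    using L1_types_generator generators_not_equivalent by metis
qed

end
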